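(* Let $\{X_E:E\in\mathcal{B}_0\}$ be a free Poisson random measure (with $\alpha=1$) in a $W^*$-probability space $(\mathcal{A},\varphi)$ such that $X_E\ge0$ for all $E\in\mathcal{B}_0$. Then the integration with respect to the random measure is a contractive mapping from $L^1_{\mathbb{R}}(\mathbb{R})$ into $L^1(\mathcal{A},\varphi)$, i.e. the integral $X(f)\in L^1(\mathcal{A},\varphi)$ is well defined and $\|X(f)\|_1\le\|f\|_1$ for every $f\in L^1_{\mathbb{R}}(\mathbb{R})$, where $L^1_{\mathbb{R}}(\mathbb{R})$ is the space of all real-valued $L^1$-functions on $\mathbb{R}$.
   Context: A $W^*$-probability space $(\mathcal{A},\varphi)$ is a finite von Neumann algebra with a faithful normal tracial state; $\|a\|_p=\varphi(|a|^p)^{1/p}$ and $L^p(\mathcal{A},\varphi)$ is the completion of $\mathcal{A}$ in $\|\cdot\|_p$, $p\ge1$. $\kappa_n(a):=\kappa_n(a,\dots,a)$ denotes the usual $n$-th free cumulant. Free Poisson random measure (with $\alpha=1$): a map $E\mapsto X_E$ from the set $\mathcal{B}_0$ of Borel subsets of $\mathbb{R}$ of finite Lebesgue measure $|E|$ into the self-adjoint elements of $\mathcal{A}$ such that (1) $\kappa_n(X_E)=|E|$ for all $n\ge1$; (2) if $E_1,\dots,E_k$ are mutually disjoint, then $X_{E_1},\dots,X_{E_k}$ are freely independent; (3) if $E_1,\dots,E_k$ are mutually disjoint, then $X_{\cup_{i=1}^kE_i}=\sum_{i=1}^kX_{E_i}$. Integral on $L^1_{\mathbb{R}}(\mathbb{R})$: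 for a real-valued simple function $s=\sum_{i=1}^nc_i\chi_{E_i}$ with $E_i\in\mathcal{B}_0$ mutually disjoint, $X(s)=\sum_{i=1}^nc_iX_{E_i}$; for $f\in L^1_{\mathbb{R}}(\mathbb{R})$, $X(f)=\int_{\mathbb{R}}f(x)X(dx):=\lim_{n\to\infty}X(s_n)$ in $L^1(\mathcal{A},\varphi)$, where $s_n$ are real-valued simple functions of this kind with $s_n\to f$ a.e. and in $L^1$. *)

theory Defs
  imports "HOL-Analysis.Analysis" "HOL-Library.Disjoint_Sets"
begin

section \<open>Complex Hilbert spaces and their bounded operators\<close>

text \<open>
  The real Hilbert space structure (norm, topology, completeness) is inherited; the complex inner
  product is linear in its first argument, and its real part is the inherited real inner product.
  Positive definiteness and the formula for the norm are therefore part of class real_inner.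
\<close>

class complex_hilbert_space = real_inner + complete_space +
  fixes scaleC :: "complex \<Rightarrow> 'a \<Rightarrow> 'a" (infixr "*\<^sub>C" 75)
    and cinner :: "'a \<Rightarrow> 'a \<Rightarrow> complex"
  assumes scaleC_add_right: "z *\<^sub>C (x + y) = z *\<^sub>C x + z *\<^sub>C y"
    and scaleC_add_left: "(z + w) *\<^sub>C x = z *\<^sub>C x + w *\<^sub>C x"
    and scaleC_scaleC: "z *\<^sub>C (w *\<^sub>C x) = (z * w) *\<^sub>C x"
    and scaleC_of_real: "complex_of_real r *\<^sub>C x = r *\<^sub>R x"
    and cinner_add_left: "cinner (x + y) u = cinner x u + cinner y u"
    and cinner_scaleC_left: "cinner (z *\<^sub>C x) y = z * cinner x y"
    and cinner_commute: "cinner x y = cnj (cinner y x)"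
    and Re_cinner: "Re (cinner x y) = inner x y"

text \<open>
  Operators are elements of the library type of bounded real-linear maps; the bounded operators on
  the complex Hilbert space are those that in addition satisfy complex_linear.
\<close>

type_synonym 'h operator = "'h \<Rightarrow>\<^sub>L 'h"

definition complex_linear :: "('h::complex_hilbert_space) operator \<Rightarrow> bool" where
  "complex_linear a \<longleftrightarrow> (\<forall>z x. blinfun_apply a (z *\<^sub>C x) = z *\<^sub>C blinfun_apply a x)"

lemma bounded_linear_scaleC: "bounded_linear ((*\<^sub>C) z :: 'h::complex_hilbert_space \<Rightarrow> 'h)"
proof (rule bounded_linear_intro[where K = "cmod z"])
  fix x y :: 'h and r :: real
  show "z *\<^sub>C (x + y) = z *\<^sub>C x + z *\<^sub>C y"
    by (rule scaleC_add_right)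
  show "z *\<^sub>C (r *\<^sub>R x) = r *\<^sub>R (z *\<^sub>C x)"
    by (simp add: scaleC_of_real[symmetric] scaleC_scaleC mult.commute)
  have "cinner (z *\<^sub>C x) (z *\<^sub>C x) = z * cnj (cinner (z *\<^sub>C x) x)"
    by (metis cinner_scaleC_left cinner_commute)
  also have "\<dots> = complex_of_real ((cmod z)\<^sup>2) * cnj (cinner x x)"
    by (simp only: cinner_scaleC_left complex_norm_square complex_cnj_mult mult.assoc)
  finally have "inner (z *\<^sub>C x) (z *\<^sub>C x) = (cmod z)\<^sup>2 * inner x x"
    by (simp add: Re_cinner[symmetric] flip: of_real_power)
  then show "norm (z *\<^sub>C x) \<le> norm x * cmod z"
    by (simp add: norm_eq_sqrt_inner real_sqrt_mult)
qed

lift_definition op_scaleC :: "complex \<Rightarrow> ('h::complex_hilbert_space) operator \<Rightarrow> 'h operator"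
  is "\<lambda>z a x. z *\<^sub>C a x"
  by (rule bounded_linear_compose[OF bounded_linear_scaleC])

definition op_adj :: "('h::complex_hilbert_space) operator \<Rightarrow> 'h operator" where
  "op_adj a = (THE b. \<forall>x y. cinner (blinfun_apply a x) y = cinner x (blinfun_apply b y))"

definition self_adjoint :: "('h::complex_hilbert_space) operator \<Rightarrow> bool" where
  "self_adjoint a \<longleftrightarrow> complex_linear a \<and> op_adj a = a"

definition op_positive :: "('h::complex_hilbert_space) operator \<Rightarrow> bool" where
  "op_positive a \<longleftrightarrow> complex_linear a \<and>
     (\<forall>x. cinner (blinfun_apply a x) x \<in> \<real> \<and> 0 \<le> Re (cinner (blinfun_apply a x) x))"

definition op_le :: "('h::complex_hilbert_space) operator \<Rightarrow> 'h operator \<Rightarrow> bool" where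
  "op_le a b \<longleftrightarrow> op_positive (b - a)"

text \<open>The absolute value of \<open>a\<close> is the positive square root of \<open>a* a\<close>.\<close>

definition op_abs :: "('h::complex_hilbert_space) operator \<Rightarrow> 'h operator" where
  "op_abs a = (THE b. op_positive b \<and> b o\<^sub>L b = op_adj a o\<^sub>L a)"

definition op_prod :: "('h::complex_hilbert_space) operator list \<Rightarrow> 'h operator" where
  "op_prod as = foldr (o\<^sub>L) as id_blinfun"


section \<open>W*-probability spaces\<close>

definition commutant :: "('h::complex_hilbert_space) operator set \<Rightarrow> 'h operator set" where
  "commutant S = {a. complex_linear a \<and> (\<forall>b\<in>S. a o\<^sub>L b = b o\<^sub>L a)}"

definition von_neumann_algebra :: "('h::complex_hilbert_space) operator set \<Rightarrow> bool" where
  "von_neumann_algebra A \<longleftrightarrow>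
     (\<forall>a\<in>A. complex_linear a \<and> op_adj a \<in> A) \<and> commutant (commutant A) = A"

definition finite_von_neumann_algebra :: "('h::complex_hilbert_space) operator set \<Rightarrow> bool" where
  "finite_von_neumann_algebra A \<longleftrightarrow> von_neumann_algebra A \<and>
     (\<forall>v\<in>A. op_adj v o\<^sub>L v = id_blinfun \<longrightarrow> v o\<^sub>L op_adj v = id_blinfun)"

text \<open>Functionals on \<open>A\<close> are total functions; only their values on \<open>A\<close> matter.\<close>

definition state_on ::
    "('h::complex_hilbert_space) operator set \<Rightarrow> ('h operator \<Rightarrow> complex) \<Rightarrow> bool" where
  "state_on A \<phi> \<longleftrightarrow>
     (\<forall>a\<in>A. \<forall>b\<in>A. \<phi> (a + b) = \<phi> a + \<phi> b) \<and>
     (\<forall>z. \<forall>a\<in>A. \<phi> (op_scaleC z a) = z * \<phi> a) \<and>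
     (\<forall>a\<in>A. op_positive a \<longrightarrow> \<phi> a \<in> \<real> \<and> 0 \<le> Re (\<phi> a)) \<and>
     \<phi> id_blinfun = 1"

definition tracial_on ::
    "('h::complex_hilbert_space) operator set \<Rightarrow> ('h operator \<Rightarrow> complex) \<Rightarrow> bool" where
  "tracial_on A \<phi> \<longleftrightarrow> (\<forall>a\<in>A. \<forall>b\<in>A. \<phi> (a o\<^sub>L b) = \<phi> (b o\<^sub>L a))"

definition faithful_on ::
    "('h::complex_hilbert_space) operator set \<Rightarrow> ('h operator \<Rightarrow> complex) \<Rightarrow> bool" where
  "faithful_on A \<phi> \<longleftrightarrow> (\<forall>a\<in>A. \<phi> (op_adj a o\<^sub>L a) = 0 \<longrightarrow> a = 0)"

text \<open>
  Normality: the functional preserves suprema of bounded increasing nets, expressed through upward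
  directed sets \<open>D\<close> of self-adjoint elements having a least upper bound \<open>s\<close>.
\<close>

definition normal_on ::
    "('h::complex_hilbert_space) operator set \<Rightarrow> ('h operator \<Rightarrow> complex) \<Rightarrow> bool" where
  "normal_on A \<phi> \<longleftrightarrow>
     (\<forall>D s. D \<noteq> {} \<and> D \<subseteq> {a \<in> A. self_adjoint a} \<and>
        (\<forall>a\<in>D. \<forall>b\<in>D. \<exists>c\<in>D. op_le a c \<and> op_le b c) \<and>
        s \<in> A \<and> self_adjoint s \<and> (\<forall>a\<in>D. op_le a s) \<and>
        (\<forall>t\<in>A. self_adjoint t \<and> (\<forall>a\<in>D. op_le a t) \<longrightarrow> op_le s t)
      \<longrightarrow> Re (\<phi> s) = (SUP a\<in>D. Re (\<phi> a)))"

definition wstar_probability_space ::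
    "('h::complex_hilbert_space) operator set \<Rightarrow> ('h operator \<Rightarrow> complex) \<Rightarrow> bool" where
  "wstar_probability_space A \<phi> \<longleftrightarrow> finite_von_neumann_algebra A \<and>
     state_on A \<phi> \<and> tracial_on A \<phi> \<and> faithful_on A \<phi> \<and> normal_on A \<phi>"


section \<open>Free cumulants and free independence\<close>

definition noncrossing :: "nat set set \<Rightarrow> bool" where
  "noncrossing P \<longleftrightarrow>
     (\<forall>V\<in>P. \<forall>W\<in>P. V \<noteq> W \<longrightarrow> \<not> (\<exists>a\<in>V. \<exists>b\<in>W. \<exists>c\<in>V. \<exists>d\<in>W. a < b \<and> b < c \<and> c < d))"

definition NC :: "nat \<Rightarrow> nat set set set" where
  "NC n = {P. partition_on {..<n} P \<and> noncrossing P}"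

lemma NC_proper_block:
  assumes "P \<in> NC n - {{{..<n}}}" "V \<in> P"
  shows "V \<subset> {..<n}"
proof -
  have P: "partition_on {..<n} P" and "P \<noteq> {{..<n}}"
    using assms(1) by (auto simp: NC_def)
  have "V \<noteq> {..<n}"
  proof
    assume V: "V = {..<n}"
    have "W = V" if W: "W \<in> P" for W
    proof (rule ccontr)
      assume "W \<noteq> V"
      then have "disjnt W V"
        using P W assms(2) by (auto simp: partition_on_def disjoint_def disjnt_def)
      moreover have "W \<subseteq> V" "W \<noteq> {}"
        using P W V by (auto simp: partition_on_def)
      ultimately show False
        by (auto simp: disjnt_def)
    qed
    then have "P = {{..<n}}"
      using assms(2) V by blast
    with \<open>P \<noteq> {{..<n}}\<close> show False ..
  qed
  moreover have "V \<subseteq> {..<n}"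
    using P assms(2) by (auto simp: partition_on_def)
  ultimately show ?thesis by auto
qed

text \<open>
  The moment-cumulant formula
  \<open>\<phi>(a\<^sub>1 \<cdots> a\<^sub>n) = \<Sum>\<pi>\<in>NC(n). \<Prod>V\<in>\<pi>. \<kappa>(a\<^sub>i : i \<in> V)\<close>
  solved for the term of the one-block partition. The arguments of the cumulant form a list.
\<close>

function free_cumulant ::
    "(('h::complex_hilbert_space) operator \<Rightarrow> complex) \<Rightarrow> 'h operator list \<Rightarrow> complex" where
  "free_cumulant \<phi> as = \<phi> (op_prod as) -
     (\<Sum>P \<in> NC (length as) - {{{..<length as}}}. \<Prod>V\<in>P. free_cumulant \<phi> (nths as V))"
  by auto
termination
proof (relation "Wellfounded.measure (\<lambda>(\<phi>, as). length as)")
  fix \<phi> :: "'h operator \<Rightarrow> complex" and as :: "'h operator list" and P V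
  assume "P \<in> NC (length as) - {{{..<length as}}}" "V \<in> P"
  then have V: "V \<subset> {..<length as}"
    by (rule NC_proper_block)
  have "length (nths as V) = card {i. i < length as \<and> i \<in> V}"
    by (rule length_nths)
  also have "\<dots> < card {..<length as}"
    by (rule psubset_card_mono) (use V in auto)
  finally show "((\<phi>, nths as V), (\<phi>, as)) \<in> Wellfounded.measure (\<lambda>(\<phi>, as). length as)"
    by simp
qed auto

declare free_cumulant.simps [simp del]

inductive_set unital_star_algebra ::
    "('h::complex_hilbert_space) operator set \<Rightarrow> 'h operator set"
  for S :: "'h operator set" where
  "a \<in> S \<Longrightarrow> a \<in> unital_star_algebra S"
| "id_blinfun \<in> unital_star_algebra S"
| "a \<in> unital_star_algebra S \<Longrightarrow> b \<in> unital_star_algebra S \<Longrightarrow> a + b \<in> unital_star_algebra S"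
| "a \<in> unital_star_algebra S \<Longrightarrow> op_scaleC z a \<in> unital_star_algebra S"
| "a \<in> unital_star_algebra S \<Longrightarrow> b \<in> unital_star_algebra S \<Longrightarrow> a o\<^sub>L b \<in> unital_star_algebra S"
| "a \<in> unital_star_algebra S \<Longrightarrow> op_adj a \<in> unital_star_algebra S"

text \<open>
  Free independence of \<open>Y\<^sub>0, \<dots>, Y\<^sub>k\<^sub>-\<^sub>1\<close>: alternating products of centred elements of the
  unital *-algebras generated by the single variables are centred.
\<close>

definition freely_independent ::
    "(('h::complex_hilbert_space) operator \<Rightarrow> complex) \<Rightarrow> nat \<Rightarrow> (nat \<Rightarrow> 'h operator) \<Rightarrow> bool" where
  "freely_independent \<phi> k Y \<longleftrightarrow>
     (\<forall>is as. is \<noteq> [] \<and> set is \<subseteq> {..<k} \<and> distinct_adj is \<and> length as = length is \<and>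
        (\<forall>j<length is. as ! j \<in> unital_star_algebra {Y (is ! j)} \<and> \<phi> (as ! j) = 0)
      \<longrightarrow> \<phi> (op_prod as) = 0)"


section \<open>Free Poisson random measures\<close>

definition finite_borel_sets :: "real set set" where
  "finite_borel_sets = {E \<in> sets borel. emeasure lborel E < \<infinity>}"

definition free_poisson_random_measure ::
    "('h::complex_hilbert_space) operator set \<Rightarrow> ('h operator \<Rightarrow> complex) \<Rightarrow>
     (real set \<Rightarrow> 'h operator) \<Rightarrow> bool" where
  "free_poisson_random_measure A \<phi> X \<longleftrightarrow>
     (\<forall>E\<in>finite_borel_sets. X E \<in> A \<and> self_adjoint (X E)) \<and>
     (\<forall>E\<in>finite_borel_sets. \<forall>n\<ge>1.
        free_cumulant \<phi> (replicate n (X E)) = complex_of_real (measure lborel E)) \<and>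
     (\<forall>k::nat. \<forall>E. 1 \<le> k \<and> (\<forall>i<k. E i \<in> finite_borel_sets) \<and> disjoint_family_on E {..<k} \<longrightarrow>
        freely_independent \<phi> k (\<lambda>i. X (E i))) \<and>
     (\<forall>k::nat. \<forall>E. 1 \<le> k \<and> (\<forall>i<k. E i \<in> finite_borel_sets) \<and> disjoint_family_on E {..<k} \<longrightarrow>
        X (\<Union>i<k. E i) = (\<Sum>i<k. X (E i)))"


section \<open>The space L1 of a W*-probability space\<close>

definition norm1 ::
    "(('h::complex_hilbert_space) operator \<Rightarrow> complex) \<Rightarrow> 'h operator \<Rightarrow> real" where
  "norm1 \<phi> a = Re (\<phi> (op_abs a))"

text \<open>
  The completion of \<open>A\<close> in the 1-norm: Cauchy sequences in \<open>A\<close> modulo sequences of vanishing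
  distance. The distance of two elements of the completion (the norm of their difference) and the
  norm are the limits along arbitrary representatives.
\<close>

definition L1_Cauchy ::
    "('h::complex_hilbert_space) operator set \<Rightarrow> ('h operator \<Rightarrow> complex) \<Rightarrow>
     (nat \<Rightarrow> 'h operator) set" where
  "L1_Cauchy A \<phi> = {u. (\<forall>n. u n \<in> A) \<and>
     (\<forall>e>0. \<exists>N. \<forall>m\<ge>N. \<forall>n\<ge>N. norm1 \<phi> (u m - u n) < e)}"

definition L1_rel ::
    "('h::complex_hilbert_space) operator set \<Rightarrow> ('h operator \<Rightarrow> complex) \<Rightarrow>
     ((nat \<Rightarrow> 'h operator) \<times> (nat \<Rightarrow> 'h operator)) set" where
  "L1_rel A \<phi> = {(u, v). u \<in> L1_Cauchy A \<phi> \<and> v \<in> L1_Cauchy A \<phi> \<and>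
     (\<lambda>n. norm1 \<phi> (u n - v n)) \<longlonglongrightarrow> 0}"

definition L1_space ::
    "('h::complex_hilbert_space) operator set \<Rightarrow> ('h operator \<Rightarrow> complex) \<Rightarrow>
     (nat \<Rightarrow> 'h operator) set set" where
  "L1_space A \<phi> = L1_Cauchy A \<phi> // L1_rel A \<phi>"

definition L1_embed ::
    "('h::complex_hilbert_space) operator set \<Rightarrow> ('h operator \<Rightarrow> complex) \<Rightarrow> 'h operator \<Rightarrow>
     (nat \<Rightarrow> 'h operator) set" where
  "L1_embed A \<phi> a = L1_rel A \<phi> `` {\<lambda>_. a}"

definition L1_dist ::
    "(('h::complex_hilbert_space) operator \<Rightarrow> complex) \<Rightarrow>
     (nat \<Rightarrow> 'h operator) set \<Rightarrow> (nat \<Rightarrow> 'h operator) set \<Rightarrow> real" where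
  "L1_dist \<phi> \<xi> \<eta> = (THE r. \<forall>u\<in>\<xi>. \<forall>v\<in>\<eta>. (\<lambda>n. norm1 \<phi> (u n - v n)) \<longlonglongrightarrow> r)"

definition L1_norm ::
    "(('h::complex_hilbert_space) operator \<Rightarrow> complex) \<Rightarrow> (nat \<Rightarrow> 'h operator) set \<Rightarrow> real" where
  "L1_norm \<phi> \<xi> = (THE r. \<forall>u\<in>\<xi>. (\<lambda>n. norm1 \<phi> (u n)) \<longlonglongrightarrow> r)"


section \<open>Integration with respect to a random measure\<close>

definition simple_repr :: "(real \<Rightarrow> real) \<Rightarrow> nat \<Rightarrow> (nat \<Rightarrow> real) \<Rightarrow> (nat \<Rightarrow> real set) \<Rightarrow> bool" where
  "simple_repr s n c E \<longleftrightarrow>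
     (\<forall>i<n. E i \<in> finite_borel_sets) \<and> disjoint_family_on E {..<n} \<and>
     s = (\<lambda>x. \<Sum>i<n. c i * indicator (E i) x)"

definition simple_fun :: "(real \<Rightarrow> real) \<Rightarrow> bool" where
  "simple_fun s \<longleftrightarrow> (\<exists>n c E. simple_repr s n c E)"

definition has_simple_integral ::
    "(real set \<Rightarrow> ('h::complex_hilbert_space) operator) \<Rightarrow> (real \<Rightarrow> real) \<Rightarrow> 'h operator \<Rightarrow> bool" where
  "has_simple_integral X s b \<longleftrightarrow>
     (\<exists>n c E. simple_repr s n c E \<and> b = (\<Sum>i<n. c i *\<^sub>R X (E i)))"

definition simple_integral ::
    "(real set \<Rightarrow> ('h::complex_hilbert_space) operator) \<Rightarrow> (real \<Rightarrow> real) \<Rightarrow> 'h operator" where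
  "simple_integral X s = (THE b. has_simple_integral X s b)"

definition approximates :: "(nat \<Rightarrow> real \<Rightarrow> real) \<Rightarrow> (real \<Rightarrow> real) \<Rightarrow> bool" where
  "approximates s f \<longleftrightarrow> (\<forall>n. simple_fun (s n)) \<and>
     (AE x in lebesgue. (\<lambda>n. s n x) \<longlonglongrightarrow> f x) \<and>
     (\<lambda>n. \<integral>x. \<bar>s n x - f x\<bar> \<partial>lebesgue) \<longlonglongrightarrow> 0"

definition is_integral ::
    "('h::complex_hilbert_space) operator set \<Rightarrow> ('h operator \<Rightarrow> complex) \<Rightarrow>
     (real set \<Rightarrow> 'h operator) \<Rightarrow> (real \<Rightarrow> real) \<Rightarrow> (nat \<Rightarrow> 'h operator) set \<Rightarrow> bool" where
  "is_integral A \<phi> X f \<xi> \<longleftrightarrow> \<xi> \<in> L1_space A \<phi> \<and>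
     (\<forall>s. approximates s f \<longrightarrow>
        (\<lambda>n. L1_dist \<phi> (L1_embed A \<phi> (simple_integral X (s n))) \<xi>) \<longlonglongrightarrow> 0)"

definition free_integral ::
    "('h::complex_hilbert_space) operator set \<Rightarrow> ('h operator \<Rightarrow> complex) \<Rightarrow>
     (real set \<Rightarrow> 'h operator) \<Rightarrow> (real \<Rightarrow> real) \<Rightarrow> (nat \<Rightarrow> 'h operator) set" where
  "free_integral A \<phi> X f = (THE \<xi>. is_integral A \<phi> X f \<xi>)"

end

theory Submission
  imports Defs
begin

text \<open>
  The trace norm of a positive operator is its mean, and the mean of \<open>X E\<close> is its first free cumulant
  \<open>\<bar>E\<bar>\<close>. Hence \<open>\<parallel>X E\<parallel>\<^sub>1 = \<bar>E\<bar>\<close>, and for disjoint sets \<open>E\<^sub>i\<close> the triangle inequality gives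
  \<open>\<parallel>\<Sum> c\<^sub>i X E\<^sub>i\<parallel>\<^sub>1 \<le> \<Sum> \<bar>c\<^sub>i\<bar> \<bar>E\<^sub>i\<bar>\<close>, which is the \<open>L\<^sup>1\<close> norm of the simple function with the values \<open>c\<^sub>i\<close> on
  \<open>E\<^sub>i\<close>. So the integral is a contraction on simple functions and extends by density to \<open>L\<^sup>1\<close>.

  The work lies in the trace norm \<open>\<parallel>a\<parallel>\<^sub>1 = \<phi> \<bar>a\<bar>\<close> of a general \<open>a\<close>, which has to be shown subadditive on
  all of \<open>A\<close> because the elements of the completion are represented by arbitrary Cauchy sequences.
  The absolute value is the square root of \<open>a* a\<close>, obtained by an iteration that converges in norm
  (\<open>op_positive_sqrt_exists\<close>); it lies in \<open>A\<close> since it commutes with the commutant. Writing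
  \<open>a = v (\<bar>a\<bar> + \<epsilon>)\<close> with a contraction \<open>v \<in> A\<close> (\<open>approximate_polar_decomposition\<close>) and using traciality
  (\<open>Re_state_contraction_le\<close>), one identifies \<open>\<parallel>a\<parallel>\<^sub>1\<close> with the supremum of \<open>Re \<phi> (u a)\<close> over the
  contractions \<open>u \<in> A\<close>, and a supremum of additive functionals is subadditive (\<open>norm1_triangle\<close>).

  Two combinations of values of \<open>X\<close> are compared by rewriting both over the atoms of all the sets
  involved (\<open>sum_over_atoms\<close>). This gives independence of the representation of a simple function
  and the bound \<open>\<parallel>X s - X t\<parallel>\<^sub>1 \<le> \<integral> \<bar>s - t\<bar>\<close> at the same time; the rest is the extension by continuity.
\<close>

section \<open>The real inner product of a complex Hilbert space\<close>

lemma cinner_scaleC_right: "cinner x (z *\<^sub>C y) = cnj z * cinner x y"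
  by (metis cinner_commute cinner_scaleC_left complex_cnj_mult)

lemma inner_scaleC_left: "inner (z *\<^sub>C x) y = inner x (cnj z *\<^sub>C y)"
  by (simp add: Re_cinner[symmetric] cinner_scaleC_left cinner_scaleC_right)

lemma Im_cinner: "Im (cinner x y) = inner x (\<i> *\<^sub>C y)"
  by (simp add: Re_cinner[symmetric] cinner_scaleC_right)

lemma scaleC_i_i: "\<i> *\<^sub>C \<i> *\<^sub>C (x::'a::complex_hilbert_space) = - x"
proof -
  have "\<i> *\<^sub>C \<i> *\<^sub>C x = complex_of_real (-1) *\<^sub>C x"
    by (simp only: scaleC_scaleC) simp
  also have "\<dots> = - x"
    by (simp only: scaleC_of_real) simp
  finally show ?thesis .
qed

lemma scaleC_minus_right: "z *\<^sub>C (- x) = - (z *\<^sub>C (x::'a::complex_hilbert_space))"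
  using bounded_linear.linear[OF bounded_linear_scaleC, of z] by (rule linear_neg)

lemma scaleC_diff_right: "z *\<^sub>C (x - y) = z *\<^sub>C x - z *\<^sub>C (y::'a::complex_hilbert_space)"
  using bounded_linear.linear[OF bounded_linear_scaleC, of z] by (rule linear_diff)

lemma scaleC_scaleR: "z *\<^sub>C (r *\<^sub>R x) = r *\<^sub>R (z *\<^sub>C (x::'a::complex_hilbert_space))"
  using bounded_linear.linear[OF bounded_linear_scaleC, of z] by (rule linear_scale)

text \<open>
  The representing vector minimises \<open>J x = \<parallel>x\<parallel>\<^sup>2 - 2 f x\<close>: by the parallelogram law every minimising
  sequence is Cauchy, and the vanishing of the derivative of \<open>J\<close> at the minimum is the claim.
\<close>

lemma riesz_representation:
  fixes f :: "'a::{real_inner,complete_space} \<Rightarrow> real"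
  assumes "bounded_linear f"
  shows "\<exists>x. \<forall>y. f y = inner x y"
proof -
  interpret bounded_linear f by fact
  define J where "J = (\<lambda>x. inner x x - 2 * f x)"
  obtain K where K: "\<And>x. \<bar>f x\<bar> \<le> norm x * K"
    using bounded by (auto simp: real_norm_def)
  have J_lower: "- (K\<^sup>2) \<le> J x" for x
  proof -
    have "0 \<le> (norm x - K)\<^sup>2"
      by simp
    then have "- (K\<^sup>2) \<le> (norm x)\<^sup>2 - 2 * (norm x * K)"
      by (simp add: power2_diff algebra_simps)
    also have "\<dots> \<le> J x"
      unfolding J_def using K[of x] by (simp add: power2_norm_eq_inner)
    finally show ?thesis .
  qed
  define m where "m = Inf (range J)"
  have bdd: "bdd_below (range J)"
    using J_lower by (intro bdd_belowI2)
  have m_le: "m \<le> J x" for x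
    unfolding m_def by (rule cInf_lower[OF _ bdd]) simp
  have "\<exists>x. J x < m + 1 / Suc n" for n
  proof -
    have "Inf (range J) < m + 1 / Suc n"
      by (simp add: m_def)
    then show ?thesis
      by (subst (asm) cInf_less_iff[OF _ bdd]) auto
  qed
  then obtain X where X: "\<And>n. J (X n) < m + 1 / Suc n"
    by metis
  have parallelogram: "(norm (x - y))\<^sup>2 = 2 * J x + 2 * J y - 4 * J ((1/2) *\<^sub>R (x + y))" for x y
    unfolding J_def power2_norm_eq_inner
    by (simp add: inner_simps add scale inner_commute algebra_simps)
  have close: "(norm (X i - X j))\<^sup>2 \<le> 2 / Suc i + 2 / Suc j" for i j
    using parallelogram[of "X i" "X j"] X[of i] X[of j] m_le[of "(1/2) *\<^sub>R (X i + X j)"] by simp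
  have "Cauchy X"
  proof (rule metric_CauchyI)
    fix e :: real
    assume e: "0 < e"
    obtain N :: nat where N: "4 / e\<^sup>2 < N"
      using reals_Archimedean2 by blast
    show "\<exists>M. \<forall>i\<ge>M. \<forall>j\<ge>M. dist (X i) (X j) < e"
    proof (intro exI allI impI)
      fix i j
      assume "N \<le> i" "N \<le> j"
      have *: "2 / Suc k < e\<^sup>2 / 2" if "N \<le> k" for k
      proof -
        have "4 / e\<^sup>2 < Suc k"
          using N that by linarith
        then show ?thesis
          using e by (simp add: field_simps)
      qed
      have "(norm (X i - X j))\<^sup>2 < e\<^sup>2"
        using close[of i j] *[OF \<open>N \<le> i\<close>] *[OF \<open>N \<le> j\<close>] by linarith
      then show "dist (X i) (X j) < e"
        using e by (simp add: dist_norm power_less_imp_less_base)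
    qed
  qed
  then obtain x where x: "X \<longlonglongrightarrow> x"
    using Cauchy_convergent_iff convergent_def by blast
  have "(\<lambda>n. J (X n)) \<longlonglongrightarrow> J x"
    unfolding J_def by (intro tendsto_intros tendsto x)
  moreover have "(\<lambda>n. m + 1 / Suc n) \<longlonglongrightarrow> m + 0"
    using LIMSEQ_inverse_real_of_nat by (intro tendsto_intros) (simp add: inverse_eq_divide)
  ultimately have "J x \<le> m + 0"
    by (rule LIMSEQ_le) (use X less_imp_le in blast)
  then have min: "J x \<le> J y" for y
    using m_le[of y] by simp
  have "f y = inner x y" for y
  proof (rule ccontr)
    assume "f y \<noteq> inner x y"
    \<comment> \<open>The step from \<open>x\<close> by \<open>- d s y\<close> changes \<open>J\<close> by \<open>d\<^sup>2 s (s \<parallel>y\<parallel>\<^sup>2 - 2)\<close>, which is negative as \<open>s \<parallel>y\<parallel>\<^sup>2 < 1\<close>.\<close>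
    define d where "d = inner x y - f y"
    define s where "s = 1 / (1 + inner y y)"
    have d: "d \<noteq> 0"
      using \<open>f y \<noteq> inner x y\<close> by (simp add: d_def)
    have yy: "0 \<le> inner y y"
      by simp
    then have s: "0 < s" "s * inner y y < 1"
      by (auto simp: s_def divide_less_eq add_pos_nonneg)
    have "J (x + t *\<^sub>R y) - J x = 2 * t * d + t\<^sup>2 * inner y y" for t
      unfolding J_def d_def
      by (simp add: inner_simps add scale inner_commute[of y x] power2_eq_square algebra_simps)
    from this[of "- d * s"]
    have "J (x + (- d * s) *\<^sub>R y) - J x = d\<^sup>2 * s * (s * inner y y - 2)"
      by (simp add: power2_eq_square algebra_simps)
    moreover have "d\<^sup>2 * s * (s * inner y y - 2) < 0"
      using d s by (intro mult_pos_neg) auto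
    ultimately show False
      using min[of "x + (- d * s) *\<^sub>R y"] by linarith
  qed
  then show ?thesis by blast
qed


section \<open>Adjoints and positive operators\<close>

lemma complex_linearD: "complex_linear a \<Longrightarrow> blinfun_apply a (z *\<^sub>C x) = z *\<^sub>C blinfun_apply a x"
  by (simp add: complex_linear_def)

lemma complex_linear_id [simp]: "complex_linear id_blinfun"
  by (simp add: complex_linear_def)

lemma complex_linear_0 [simp]: "complex_linear 0"
  using scaleC_minus_right[of _ 0]
  by (auto simp: complex_linear_def bounded_linear.linear[OF bounded_linear_scaleC] linear_0)

lemma complex_linear_add [simp]:
  "complex_linear a \<Longrightarrow> complex_linear b \<Longrightarrow> complex_linear (a + b)"
  by (simp add: complex_linear_def blinfun.add_left scaleC_add_right)

lemma complex_linear_diff [simp]: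
  "complex_linear a \<Longrightarrow> complex_linear b \<Longrightarrow> complex_linear (a - b)"
  by (simp add: complex_linear_def blinfun.diff_left scaleC_diff_right)

lemma complex_linear_scaleR [simp]: "complex_linear a \<Longrightarrow> complex_linear (r *\<^sub>R a)"
  by (simp add: complex_linear_def blinfun.scaleR_left scaleC_scaleR)

lemma complex_linear_scaleC [simp]: "complex_linear a \<Longrightarrow> complex_linear (op_scaleC z a)"
  by (simp add: complex_linear_def op_scaleC.rep_eq scaleC_scaleC mult.commute)

lemma complex_linear_compose [simp]:
  "complex_linear a \<Longrightarrow> complex_linear b \<Longrightarrow> complex_linear (a o\<^sub>L b)"
  by (simp add: complex_linear_def)

text \<open>For complex-linear operators, adjointness may be tested on the real inner product.\<close>

lemma cinner_adjoint_iff: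
  fixes a b :: "('h::complex_hilbert_space) operator"
  assumes "complex_linear a"
  shows "(\<forall>x y. cinner (a x) y = cinner x (b y)) \<longleftrightarrow> (\<forall>x y. inner (a x) y = inner x (b y))"
proof
  assume "\<forall>x y. cinner (a x) y = cinner x (b y)"
  then show "\<forall>x y. inner (a x) y = inner x (b y)"
    by (simp flip: Re_cinner)
next
  assume *: "\<forall>x y. inner (a x) y = inner x (b y)"
  have "inner (a x) (\<i> *\<^sub>C y) = inner x (\<i> *\<^sub>C b y)" for x y
    using *[rule_format, of "(- \<i>) *\<^sub>C x" y] assms
    by (simp add: inner_scaleC_left complex_linearD)
  then show "\<forall>x y. cinner (a x) y = cinner x (b y)"
    using * by (simp add: complex_eq_iff Re_cinner Im_cinner)
qed

lemma op_adj_eqI: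
  fixes a b :: "('h::complex_hilbert_space) operator"
  assumes "complex_linear a" "\<And>x y. inner (a x) y = inner x (b y)"
  shows "op_adj a = b"
  unfolding op_adj_def cinner_adjoint_iff[OF assms(1)]
proof (rule the_equality)
  show "\<forall>x y. inner (a x) y = inner x (b y)"
    using assms(2) by blast
  fix c :: "'h operator"
  assume "\<forall>x y. inner (a x) y = inner x (c y)"
  then have "inner x (c y) = inner x (b y)" for x y
    using assms(2) by metis
  then show "c = b"
    by (intro blinfun_eqI) (metis vector_eq_ldot)
qed

lemma adjoint_exists:
  fixes a :: "('h::complex_hilbert_space) operator"
  shows "\<exists>b::'h operator. \<forall>x y. inner (a x) y = inner x (b y)"
proof -
  have "\<exists>w. \<forall>x. inner (a x) y = inner w x" for y
    by (rule riesz_representation)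
      (intro bounded_linear_compose[OF bounded_linear_inner_left] blinfun.bounded_linear_right)
  then obtain B where B: "\<And>x y. inner (a x) y = inner (B y) x"
    by metis
  have "bounded_linear B"
  proof (rule bounded_linear_intro)
    fix x y :: 'h and r :: real
    show "B (x + y) = B x + B y"
      by (rule vector_eq_rdot[THEN iffD1]) (simp add: B[symmetric] inner_add_left inner_add_right)
    show "B (r *\<^sub>R x) = r *\<^sub>R B x"
      by (rule vector_eq_rdot[THEN iffD1]) (simp add: B[symmetric])
    have "(norm (B x))\<^sup>2 = inner (a (B x)) x"
      by (simp add: B power2_norm_eq_inner)
    also have "\<dots> \<le> norm (a (B x)) * norm x"
      by (rule norm_cauchy_schwarz)
    also have "\<dots> \<le> (norm a * norm (B x)) * norm x"
      by (intro mult_right_mono norm_blinfun) simp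
    finally have "norm (B x) * norm (B x) \<le> norm (B x) * (norm x * norm a)"
      by (simp add: power2_eq_square algebra_simps)
    then show "norm (B x) \<le> norm x * norm a"
      by (cases "B x = 0") (auto simp: mult_le_cancel_left_pos)
  qed
  then show ?thesis
    using B by (intro exI[of _ "Blinfun B"])
      (simp add: bounded_linear_Blinfun_apply inner_commute[of _ "B _"])
qed

lemma inner_op_adj:
  fixes a :: "('h::complex_hilbert_space) operator"
  assumes "complex_linear a"
  shows "inner (a x) y = inner x (op_adj a y)"
  using adjoint_exists[of a] op_adj_eqI[OF assms] by metis

lemma inner_op_adj':
  fixes a :: "('h::complex_hilbert_space) operator"
  assumes "complex_linear a"
  shows "inner (op_adj a x) y = inner x (a y)"
  using inner_op_adj[OF assms] by (metis inner_commute)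

lemma complex_linear_op_adj [simp]:
  fixes a :: "('h::complex_hilbert_space) operator"
  assumes "complex_linear a"
  shows "complex_linear (op_adj a)"
  unfolding complex_linear_def
proof (intro allI)
  fix z and y :: 'h
  have "inner (op_adj a (z *\<^sub>C y)) x = inner (z *\<^sub>C op_adj a y) x" for x
    using assms by (simp add: inner_op_adj' inner_scaleC_left complex_linearD)
  then show "op_adj a (z *\<^sub>C y) = z *\<^sub>C op_adj a y"
    by (metis vector_eq_rdot)
qed

lemma op_adj_adj:
  fixes a :: "('h::complex_hilbert_space) operator"
  assumes "complex_linear a"
  shows "op_adj (op_adj a) = a"
  using assms by (intro op_adj_eqI) (simp_all add: inner_op_adj')

lemma op_adj_compose:
  fixes a :: "('h::complex_hilbert_space) operator"
  assumes "complex_linear a" "complex_linear b"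
  shows "op_adj (a o\<^sub>L b) = op_adj b o\<^sub>L op_adj a"
  using assms by (intro op_adj_eqI) (simp_all add: inner_op_adj)

lemma op_adj_scaleR:
  fixes a :: "('h::complex_hilbert_space) operator"
  assumes "complex_linear a"
  shows "op_adj (r *\<^sub>R a) = r *\<^sub>R op_adj a"
  using assms by (intro op_adj_eqI) (simp_all add: inner_op_adj blinfun.scaleR_left)

lemma norm_op_adj_contraction:
  fixes u :: "('h::complex_hilbert_space) operator"
  assumes "complex_linear u" "\<And>x. norm (u x) \<le> norm x"
  shows "norm (op_adj u x) \<le> norm x"
proof -
  have "(norm (op_adj u x))\<^sup>2 = inner (u (op_adj u x)) x"
    using assms(1) by (simp add: inner_op_adj power2_norm_eq_inner)
  also have "\<dots> \<le> norm (u (op_adj u x)) * norm x"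
    by (rule norm_cauchy_schwarz)
  also have "\<dots> \<le> norm (op_adj u x) * norm x"
    by (intro mult_right_mono assms) simp
  finally have "norm (op_adj u x) * norm (op_adj u x) \<le> norm (op_adj u x) * norm x"
    by (simp add: power2_eq_square)
  then show ?thesis
    by (cases "op_adj u x = 0") (auto simp: mult_le_cancel_left_pos)
qed

text \<open>
  Symmetry of a positive operator is the polarisation identity: \<open>\<langle>a x, x\<rangle>\<close> is real for all \<open>x\<close>.
\<close>

lemma op_positive_iff:
  fixes a :: "('h::complex_hilbert_space) operator"
  shows "op_positive a \<longleftrightarrow> complex_linear a \<and> (\<forall>x y. inner (a x) y = inner x (a y)) \<and>
    (\<forall>x. 0 \<le> inner (a x) x)"
proof
  assume "op_positive a"
  then have a: "complex_linear a" and real: "\<And>x. inner (a x) (\<i> *\<^sub>C x) = 0"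
    and pos: "\<And>x. 0 \<le> inner (a x) x"
    by (auto simp: op_positive_def complex_is_Real_iff Im_cinner Re_cinner)
  have "inner (a x) y = inner x (a y)" for x y
  proof -
    have "inner (a x) (\<i> *\<^sub>C v) + inner (a v) (\<i> *\<^sub>C x) = 0" for v
      using real[of "x + v"] real[of x] real[of v]
      by (simp add: blinfun.add_right scaleC_add_right inner_simps)
    from this[of "\<i> *\<^sub>C y"] have "inner (a x) (- y) + inner (\<i> *\<^sub>C a y) (\<i> *\<^sub>C x) = 0"
      using a by (simp add: scaleC_i_i complex_linearD)
    moreover have "cnj \<i> *\<^sub>C \<i> *\<^sub>C x = x"
      using scaleC_of_real[of 1 x] by (simp add: scaleC_scaleC)
    then have "inner (\<i> *\<^sub>C a y) (\<i> *\<^sub>C x) = inner (a y) x"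
      by (simp only: inner_scaleC_left)
    ultimately show ?thesis
      by (simp add: inner_commute)
  qed
  with a pos show "complex_linear a \<and> (\<forall>x y. inner (a x) y = inner x (a y)) \<and>
    (\<forall>x. 0 \<le> inner (a x) x)"
    by blast
next
  assume a: "complex_linear a \<and> (\<forall>x y. inner (a x) y = inner x (a y)) \<and>
    (\<forall>x. 0 \<le> inner (a x) x)"
  have "cinner (a x) x = cinner x (a x)" for x
    using cinner_adjoint_iff[of a a] a by blast
  then have "cinner (a x) x \<in> \<real>" for x
    by (metis Reals_cnj_iff cinner_commute)
  with a show "op_positive a"
    unfolding op_positive_def Re_cinner by blast
qed

lemma op_positive_self_adjoint:
  assumes "op_positive h"
  shows "op_adj h = h"
  using assms by (intro op_adj_eqI) (auto simp: op_positive_iff)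

lemma op_positive_id [simp]: "op_positive id_blinfun"
  by (simp add: op_positive_iff)

lemma op_positive_add: "op_positive a \<Longrightarrow> op_positive b \<Longrightarrow> op_positive (a + b)"
  unfolding op_positive_iff by (auto simp: blinfun.add_left inner_add_left inner_add_right)

lemma op_positive_scaleR: "op_positive a \<Longrightarrow> 0 \<le> r \<Longrightarrow> op_positive (r *\<^sub>R a)"
  unfolding op_positive_iff by (auto simp: blinfun.scaleR_left)

lemma op_positive_adj_compose:
  fixes a :: "('h::complex_hilbert_space) operator"
  shows "complex_linear a \<Longrightarrow> op_positive (op_adj a o\<^sub>L a)"
  by (simp add: op_positive_iff inner_op_adj' inner_op_adj[symmetric])

text \<open>The Cauchy--Schwarz inequality for the form \<open>\<langle>h x, y\<rangle>\<close>, with \<open>y = h x\<close>.\<close>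

lemma op_positive_norm_square_le:
  fixes h :: "('h::complex_hilbert_space) operator"
  assumes "op_positive h"
  shows "(norm (h x))\<^sup>2 \<le> norm h * inner (h x) x"
proof (cases "norm h = 0")
  case False
  define N where "N = norm h"
  have N: "0 < N"
    using False by (simp add: N_def)
  have sym: "inner (h u) v = inner u (h v)" and pos: "0 \<le> inner (h u) u" for u v
    using assms by (auto simp: op_positive_iff)
  define y where "y = h x"
  have "inner (h y) y \<le> norm (h y) * norm y"
    by (rule norm_cauchy_schwarz)
  also have "\<dots> \<le> (N * norm y) * norm y"
    unfolding N_def by (intro mult_right_mono norm_blinfun) simp
  finally have hy: "inner (h y) y \<le> N * (norm y)\<^sup>2"
    by (simp add: power2_eq_square)
  have "0 \<le> N\<^sup>2 * inner (h (x - (1 / N) *\<^sub>R y)) (x - (1 / N) *\<^sub>R y)"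
    by (simp add: pos)
  also have "\<dots> = N\<^sup>2 * inner (h x) x - 2 * N * (norm y)\<^sup>2 + inner (h y) y"
    using N sym[of y x]
    by (simp add: blinfun.diff_right blinfun.scaleR_right inner_simps dot_square_norm
        y_def[symmetric] inner_commute[of x] power2_eq_square field_simps)
  also have "\<dots> \<le> N\<^sup>2 * inner (h x) x - N * (norm y)\<^sup>2"
    using hy by simp
  finally have "N * (norm y)\<^sup>2 \<le> N * (N * inner (h x) x)"
    by (simp add: power2_eq_square)
  then show ?thesis
    using N by (simp add: N_def y_def)
qed simp

lemma op_positive_inner_eq_0:
  fixes h :: "('h::complex_hilbert_space) operator"
  assumes "op_positive h" "inner (h x) x = 0"
  shows "h x = 0"
  using op_positive_norm_square_le[OF assms(1), of x] assms(2) by simp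

section \<open>Square roots, absolute values and resolvents\<close>

text \<open>This makes the space of operators complete, so that limits of Cauchy sequences exist.\<close>

subclass (in complex_hilbert_space) banach ..

interpretation compose: bounded_bilinear "(o\<^sub>L)"
  by (rule bounded_bilinear_blinfun_compose)

lemma compose_id [simp]: "id_blinfun o\<^sub>L a = a" "a o\<^sub>L id_blinfun = a"
  by (auto intro: blinfun_eqI)

lemma compose_assoc: "(a o\<^sub>L b) o\<^sub>L c = a o\<^sub>L (b o\<^sub>L c)"
  by (rule blinfun_eqI) simp

text \<open>
  With \<open>z = 1 - t h\<close>, \<open>\<parallel>z\<parallel> \<le> 1\<close>, the fixed point equation \<open>y = (z + y\<^sup>2) / 2\<close> says
  \<open>(1 - y)\<^sup>2 = t h\<close>. The iterates from \<open>0\<close> move by at most as much as those of the scalar equation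
  \<open>\<tau> = (1 + \<tau>\<^sup>2) / 2\<close>, which increase and stay below \<open>1\<close>; so the iterates converge in norm although the
  iteration is not a contraction. Being limits of polynomials in \<open>h\<close>, they keep commuting with
  everything that commutes with \<open>h\<close>.
\<close>

lemma op_positive_sqrt_exists:
  fixes h :: "('h::complex_hilbert_space) operator"
  assumes "op_positive h"
  shows "\<exists>k. op_positive k \<and> k o\<^sub>L k = h \<and>
    (\<forall>c. c o\<^sub>L h = h o\<^sub>L c \<longrightarrow> c o\<^sub>L k = k o\<^sub>L c)"
proof -
  have h: "complex_linear h" and h_sym: "\<And>x y. inner (h x) y = inner x (h y)"
    and h_pos: "\<And>x. 0 \<le> inner (h x) x"
    using assms by (auto simp: op_positive_iff)
  define t where "t = 1 / (norm h + 1)"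
  have t: "0 < t" "t * norm h \<le> 1"
    by (auto simp: t_def divide_le_eq add_nonneg_pos)
  define z where "z = id_blinfun - t *\<^sub>R h"
  have "norm (z x) \<le> norm x" for x
  proof -
    have "(norm (z x))\<^sup>2 = (norm x)\<^sup>2 - 2 * t * inner (h x) x + t\<^sup>2 * (norm (h x))\<^sup>2"
      unfolding power2_norm_eq_inner
      by (simp add: z_def blinfun.diff_left blinfun.scaleR_left inner_simps
          inner_commute[of x "h x"] power2_eq_square algebra_simps)
    also have "\<dots> \<le> (norm x)\<^sup>2 - 2 * t * inner (h x) x + t\<^sup>2 * (norm h * inner (h x) x)"
      using op_positive_norm_square_le[OF assms, of x] by (simp add: mult_left_mono)
    also have "\<dots> = (norm x)\<^sup>2 - (2 - t * norm h) * (t * inner (h x) x)"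
      by (simp add: power2_eq_square algebra_simps)
    also have "\<dots> \<le> (norm x)\<^sup>2"
    proof -
      have "0 \<le> (2 - t * norm h) * (t * inner (h x) x)"
        using t by (intro mult_nonneg_nonneg h_pos) auto
      then show ?thesis by linarith
    qed
    finally show ?thesis
      by (rule power2_le_imp_le) simp
  qed
  then have norm_z: "norm z \<le> 1"
    by (intro norm_blinfun_bound) auto

  define y where "y = rec_nat (0 :: 'h operator) (\<lambda>_ w. (1/2) *\<^sub>R (z + (w o\<^sub>L w)))"
  define \<tau> where "\<tau> = rec_nat (0 :: real) (\<lambda>_ r. (1 + r\<^sup>2) / 2)"
  have y_0: "y 0 = 0" and y_Suc: "\<And>n. y (Suc n) = (1/2) *\<^sub>R (z + (y n o\<^sub>L y n))"
    by (simp_all add: y_def)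
  have \<tau>_0: "\<tau> 0 = 0" and \<tau>_Suc: "\<And>n. \<tau> (Suc n) = (1 + (\<tau> n)\<^sup>2) / 2"
    by (simp_all add: \<tau>_def)
  have \<tau>_bounds: "0 \<le> \<tau> n" "\<tau> n \<le> 1" for n
    by (induction n) (auto simp: \<tau>_0 \<tau>_Suc power_le_one)
  have \<tau>_mono: "\<tau> n \<le> \<tau> (Suc n)" for n
    using zero_le_power2[of "1 - \<tau> n"] by (simp add: \<tau>_Suc power2_diff)
  have y_le: "norm (y n) \<le> \<tau> n" for n
  proof (induction n)
    case (Suc n)
    have "norm (y n o\<^sub>L y n) \<le> norm (y n) * norm (y n)"
      by (rule norm_blinfun_compose)
    also have "\<dots> \<le> \<tau> n * \<tau> n"
      using Suc by (intro mult_mono) (auto simp: \<tau>_bounds)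
    finally show ?case
      using norm_z norm_triangle_ineq[of z "y n o\<^sub>L y n"]
      by (simp add: y_Suc \<tau>_Suc power2_eq_square)
  qed (simp add: y_0 \<tau>_0)
  have y_step: "norm (y (Suc n) - y n) \<le> \<tau> (Suc n) - \<tau> n" for n
  proof (induction n)
    case 0
    show ?case
      using norm_z by (simp add: y_0 y_Suc \<tau>_0 \<tau>_Suc)
  next
    case (Suc n)
    let ?d = "y (Suc n) - y n"
    have "y (Suc (Suc n)) - y (Suc n)
        = (1/2) *\<^sub>R ((y (Suc n) o\<^sub>L y (Suc n)) - (y n o\<^sub>L y n))"
      unfolding y_Suc[of "Suc n"] by (subst y_Suc[of n]) (simp add: algebra_simps)
    also have "(y (Suc n) o\<^sub>L y (Suc n)) - (y n o\<^sub>L y n) = (y (Suc n) o\<^sub>L ?d) + (?d o\<^sub>L y n)"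
      by (simp add: compose.diff_left compose.diff_right)
    finally have eq: "y (Suc (Suc n)) - y (Suc n) = (1/2) *\<^sub>R ((y (Suc n) o\<^sub>L ?d) + (?d o\<^sub>L y n))" .
    have "norm (y (Suc n) o\<^sub>L ?d) \<le> \<tau> (Suc n) * (\<tau> (Suc n) - \<tau> n)"
      using Suc y_le[of "Suc n"]
      by (intro order.trans[OF norm_blinfun_compose] mult_mono) (auto simp: \<tau>_bounds)
    moreover have "norm (?d o\<^sub>L y n) \<le> (\<tau> (Suc n) - \<tau> n) * \<tau> n"
      using Suc y_le[of n] \<tau>_mono[of n]
      by (intro order.trans[OF norm_blinfun_compose] mult_mono) (auto simp: \<tau>_bounds)
    moreover have "norm ((y (Suc n) o\<^sub>L ?d) + (?d o\<^sub>L y n))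
        \<le> norm (y (Suc n) o\<^sub>L ?d) + norm (?d o\<^sub>L y n)"
      by (rule norm_triangle_ineq)
    moreover have "\<tau> (Suc (Suc n)) - \<tau> (Suc n)
        = (\<tau> (Suc n) * (\<tau> (Suc n) - \<tau> n) + (\<tau> (Suc n) - \<tau> n) * \<tau> n) / 2"
    proof -
      have "\<tau> (Suc (Suc n)) - \<tau> (Suc n) = (1 + (\<tau> (Suc n))\<^sup>2) / 2 - (1 + (\<tau> n)\<^sup>2) / 2"
        by (rule arg_cong2[of _ _ _ _ "(-)", OF \<tau>_Suc \<tau>_Suc])
      also have "\<dots> = (\<tau> (Suc n) * (\<tau> (Suc n) - \<tau> n) + (\<tau> (Suc n) - \<tau> n) * \<tau> n) / 2"
        by (simp add: power2_eq_square field_simps)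
      finally show ?thesis .
    qed
    ultimately show ?case
      unfolding eq by simp
  qed
  have y_dist: "norm (y m - y n) \<le> \<tau> m - \<tau> n" if "n \<le> m" for m n
    using that
  proof (induction rule: dec_induct)
    case (step m)
    have "norm (y (Suc m) - y n) \<le> norm (y (Suc m) - y m) + norm (y m - y n)"
      using norm_triangle_ineq[of "y (Suc m) - y m" "y m - y n"] by simp
    then show ?case
      using step.IH y_step[of m] by simp
  qed simp
  have "convergent \<tau>"
    using \<tau>_bounds \<tau>_mono
    by (intro Bseq_monoseq_convergent[of \<tau>] BseqI'[of \<tau> 1] mono_SucI1) auto
  then have "Cauchy \<tau>"
    by (simp add: Cauchy_convergent_iff)
  have "Cauchy y"
  proof (rule CauchyI')
    fix e :: real
    assume "0 < e"
    with \<open>Cauchy \<tau>\<close> obtain M where M: "\<And>m n. m \<ge> M \<Longrightarrow> n \<ge> M \<Longrightarrow> norm (\<tau> m - \<tau> n) < e"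
      using CauchyD by blast
    show "\<exists>M. \<forall>m\<ge>M. \<forall>n>m. dist (y m) (y n) < e"
    proof (intro exI allI impI)
      fix m n
      assume "M \<le> m" "m < n"
      then have "norm (y n - y m) \<le> \<tau> n - \<tau> m" "norm (\<tau> n - \<tau> m) < e"
        using y_dist M by auto
      then show "dist (y m) (y n) < e"
        by (simp add: dist_norm norm_minus_commute)
    qed
  qed
  then obtain w where w: "y \<longlonglongrightarrow> w"
    using Cauchy_convergent_iff convergent_def by blast
  have w_app: "(\<lambda>n. y n x) \<longlonglongrightarrow> w x" for x
    by (rule blinfun.tendsto[OF w tendsto_const])

  have y_cl: "complex_linear (y n)" for n
    by (induction n) (simp_all add: y_0 y_Suc z_def h)
  have "(\<lambda>n. y n (c *\<^sub>C x)) \<longlonglongrightarrow> c *\<^sub>C w x" for c x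
    using bounded_linear.tendsto[OF bounded_linear_scaleC w_app[of x], of c]
    by (simp add: complex_linearD[OF y_cl])
  then have w_cl: "complex_linear w"
    unfolding complex_linear_def using LIMSEQ_unique[OF w_app] by blast
  have y_sym: "inner (y n x) v = inner x (y n v)" for n x v
    by (induction n arbitrary: x v)
      (simp_all add: y_0 y_Suc z_def blinfun.scaleR_left blinfun.add_left blinfun.diff_left
        inner_simps h_sym)
  have w_sym: "inner (w x) v = inner x (w v)" for x v
  proof (rule LIMSEQ_unique)
    show "(\<lambda>n. inner (y n x) v) \<longlonglongrightarrow> inner (w x) v"
      by (intro tendsto_intros w_app)
    show "(\<lambda>n. inner (y n x) v) \<longlonglongrightarrow> inner x (w v)"
      unfolding y_sym by (intro tendsto_intros w_app)
  qed
  have w_comm: "c o\<^sub>L w = w o\<^sub>L c" if c: "c o\<^sub>L h = h o\<^sub>L c" for c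
  proof -
    have "c o\<^sub>L y n = y n o\<^sub>L c" for n
    proof (induction n)
      case (Suc n)
      have "c o\<^sub>L (y n o\<^sub>L y n) = (y n o\<^sub>L y n) o\<^sub>L c"
        using Suc by (metis compose_assoc)
      then show ?case
        using c by (simp add: y_Suc z_def compose.add_left compose.add_right compose.diff_left
            compose.diff_right compose.scaleR_left compose.scaleR_right)
    qed (simp add: y_0)
    then have "(\<lambda>n. c o\<^sub>L y n) \<longlonglongrightarrow> (w o\<^sub>L c)"
      by (simp only:) (intro compose.tendsto w tendsto_const)
    then show ?thesis
      by (rule LIMSEQ_unique[OF compose.tendsto[OF tendsto_const w]])
  qed
  have w_fix: "w = (1/2) *\<^sub>R (z + (w o\<^sub>L w))"
  proof (rule LIMSEQ_unique)
    show "(\<lambda>n. y (Suc n)) \<longlonglongrightarrow> w"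
      using w by (simp add: LIMSEQ_Suc)
    show "(\<lambda>n. y (Suc n)) \<longlonglongrightarrow> (1/2) *\<^sub>R (z + (w o\<^sub>L w))"
      unfolding y_Suc by (intro tendsto_intros compose.tendsto w)
  qed
  have "norm (y n) \<le> 1" for n
    using y_le[of n] \<tau>_bounds(2)[of n] by linarith
  then have "norm w \<le> 1"
    by (intro LIMSEQ_le_const2[OF tendsto_norm[OF w]]) auto

  define r where "r = 1 / sqrt t"
  define k where "k = r *\<^sub>R (id_blinfun - w)"
  have r: "0 \<le> r" "r * r = 1 / t"
    using t by (auto simp: r_def)
  have "0 \<le> inner ((id_blinfun - w) x) x" for x
  proof -
    have "inner (w x) x \<le> norm (w x) * norm x"
      by (rule norm_cauchy_schwarz)
    also have "\<dots> \<le> (1 * norm x) * norm x"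
      using \<open>norm w \<le> 1\<close>
      by (intro mult_right_mono order.trans[OF norm_blinfun]) auto
    finally show ?thesis
      by (simp add: blinfun.diff_left inner_simps power2_norm_eq_inner[symmetric] power2_eq_square)
  qed
  then have "op_positive k"
    unfolding k_def using w_cl w_sym r
    by (intro op_positive_scaleR) (simp_all add: op_positive_iff blinfun.diff_left inner_simps)
  moreover have "k o\<^sub>L k = h"
  proof -
    have "(2::real) *\<^sub>R w = 2 *\<^sub>R ((1/2) *\<^sub>R (z + (w o\<^sub>L w)))"
      using w_fix by simp
    then have "w o\<^sub>L w = 2 *\<^sub>R w - id_blinfun + t *\<^sub>R h"
      by (simp add: z_def)
    then have "(id_blinfun - w) o\<^sub>L (id_blinfun - w) = t *\<^sub>R h"
      by (simp add: compose.diff_left compose.diff_right scaleR_2)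
    then have "k o\<^sub>L k = (r * r * t) *\<^sub>R h"
      by (simp add: k_def compose.scaleR_left compose.scaleR_right mult.assoc)
    also have "r * r * t = 1"
      using t r by simp
    finally show ?thesis by simp
  qed
  moreover have "c o\<^sub>L k = k o\<^sub>L c" if "c o\<^sub>L h = h o\<^sub>L c" for c
    using w_comm[OF that]
    by (simp add: k_def compose.scaleR_left compose.scaleR_right compose.diff_left compose.diff_right)
  ultimately show ?thesis by blast
qed

text \<open>
  For \<open>y = (s - t) x\<close> one has \<open>\<langle>s y, y\<rangle> + \<langle>t y, y\<rangle> = \<langle>(s\<^sup>2 - t\<^sup>2) x, y\<rangle> = 0\<close>, so \<open>s y = t y = 0\<close> and
  \<open>\<parallel>y\<parallel>\<^sup>2 = \<langle>(s - t) y, x\<rangle> = 0\<close>.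
\<close>

lemma commuting_sqrt_unique:
  fixes s t :: "('h::complex_hilbert_space) operator"
  assumes s: "op_positive s" and t: "op_positive t"
    and sq: "s o\<^sub>L s = t o\<^sub>L t" and comm: "s o\<^sub>L t = t o\<^sub>L s"
  shows "s = t"
proof (rule blinfun_eqI)
  fix x
  define y where "y = s x - t x"
  have "s (s v) = t (t v)" "s (t v) = t (s v)" for v
    using sq comm by (metis blinfun_apply_blinfun_compose)+
  then have "s y + t y = 0"
    by (simp add: y_def blinfun.diff_right)
  then have "inner (s y) y + inner (t y) y = 0"
    by (metis inner_add_left inner_zero_left)
  moreover have "0 \<le> inner (s y) y" "0 \<le> inner (t y) y"
    using s t by (auto simp: op_positive_iff)
  ultimately have "inner (s y) y = 0" "inner (t y) y = 0"
    by linarith+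
  then have "s y = 0" "t y = 0"
    using op_positive_inner_eq_0 s t by blast+
  moreover have "inner y y = inner (s y - t y) x"
  proof -
    have "inner (s y) x = inner y (s x)" "inner (t y) x = inner y (t x)"
      using s t by (auto simp: op_positive_iff)
    then show ?thesis
      by (simp add: y_def[of] inner_diff_left inner_diff_right)
  qed
  ultimately show "s x = t x"
    by (simp add: y_def)
qed

lemma op_positive_sqrt_unique:
  fixes s t :: "('h::complex_hilbert_space) operator"
  assumes "op_positive s" "op_positive t" "s o\<^sub>L s = t o\<^sub>L t"
  shows "s = t"
proof -
  have "op_positive (s o\<^sub>L s)"
    using op_positive_adj_compose[of s] assms(1) op_positive_self_adjoint[OF assms(1)]
    by (metis op_positive_iff)
  then obtain k where k: "op_positive k" "k o\<^sub>L k = s o\<^sub>L s"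
    "\<And>c. c o\<^sub>L (s o\<^sub>L s) = (s o\<^sub>L s) o\<^sub>L c \<Longrightarrow> c o\<^sub>L k = k o\<^sub>L c"
    using op_positive_sqrt_exists by blast
  have "s = k"
  proof (rule commuting_sqrt_unique[OF assms(1) k(1) k(2)[symmetric]])
    show "s o\<^sub>L k = k o\<^sub>L s"
      by (rule k(3)) (simp only: compose_assoc)
  qed
  moreover have "t = k"
  proof (rule commuting_sqrt_unique[OF assms(2) k(1)])
    show "t o\<^sub>L t = k o\<^sub>L k"
      using assms(3) k(2) by (rule trans[OF sym sym])
    show "t o\<^sub>L k = k o\<^sub>L t"
      by (rule k(3)) (simp add: assms(3) compose_assoc)
  qed
  ultimately show ?thesis by simp
qed

lemma
  fixes a :: "('h::complex_hilbert_space) operator"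
  assumes a: "complex_linear a"
  shows op_abs_positive: "op_positive (op_abs a)"
    and op_abs_square: "op_abs a o\<^sub>L op_abs a = op_adj a o\<^sub>L a"
    and op_abs_commute:
      "c o\<^sub>L (op_adj a o\<^sub>L a) = (op_adj a o\<^sub>L a) o\<^sub>L c \<Longrightarrow> c o\<^sub>L op_abs a = op_abs a o\<^sub>L c"
proof -
  obtain k where k: "op_positive k" "k o\<^sub>L k = op_adj a o\<^sub>L a"
    and comm: "\<forall>c. c o\<^sub>L (op_adj a o\<^sub>L a) = (op_adj a o\<^sub>L a) o\<^sub>L c \<longrightarrow> c o\<^sub>L k = k o\<^sub>L c"
    using op_positive_sqrt_exists[OF op_positive_adj_compose[OF a]] by (elim exE conjE) (rule that)
  have "op_abs a = k"
    unfolding op_abs_def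
  proof (rule the_equality)
    fix b
    assume "op_positive b \<and> b o\<^sub>L b = op_adj a o\<^sub>L a"
    with k(1,2) show "b = k"
      by (auto intro!: op_positive_sqrt_unique[of b k])
  qed (use k in blast)
  then show "op_positive (op_abs a)" "op_abs a o\<^sub>L op_abs a = op_adj a o\<^sub>L a"
    using k by simp_all
  assume "c o\<^sub>L (op_adj a o\<^sub>L a) = (op_adj a o\<^sub>L a) o\<^sub>L c"
  then show "c o\<^sub>L op_abs a = op_abs a o\<^sub>L c"
    unfolding \<open>op_abs a = k\<close> using comm by blast
qed

lemma op_abs_eqI:
  fixes a :: "('h::complex_hilbert_space) operator"
  assumes "complex_linear a" "op_positive k" "k o\<^sub>L k = op_adj a o\<^sub>L a"
  shows "op_abs a = k"
  using assms
  by (auto intro!: op_positive_sqrt_unique[of "op_abs a" k] op_abs_positive simp: op_abs_square)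

lemma op_abs_of_positive: "op_positive h \<Longrightarrow> op_abs h = h"
  by (intro op_abs_eqI) (auto simp: op_positive_self_adjoint op_positive_iff)

lemma op_abs_scaleR:
  fixes a :: "('h::complex_hilbert_space) operator"
  assumes "complex_linear a"
  shows "op_abs (r *\<^sub>R a) = \<bar>r\<bar> *\<^sub>R op_abs a"
  using assms
  by (intro op_abs_eqI)
    (simp_all add: op_positive_scaleR op_abs_positive op_adj_scaleR op_abs_square
      compose.scaleR_left compose.scaleR_right)

lemma norm_op_abs_apply:
  fixes a :: "('h::complex_hilbert_space) operator"
  assumes a: "complex_linear a"
  shows "norm (op_abs a x) = norm (a x)"
proof -
  have "inner (op_abs a x) (op_abs a x) = inner (op_abs a (op_abs a x)) x"
    using op_abs_positive[OF a] by (simp add: op_positive_iff)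
  also have "op_abs a (op_abs a x) = op_adj a (a x)"
    using op_abs_square[OF a] by (metis blinfun_apply_blinfun_compose)
  also have "inner (op_adj a (a x)) x = inner (a x) (a x)"
    using a by (simp add: inner_op_adj')
  finally show ?thesis
    by (simp add: norm_eq_sqrt_inner)
qed

text \<open>
  The operator \<open>p = h + \<epsilon>\<close> is bounded below by \<open>\<epsilon>\<close>, hence injective with bounded inverse. It is onto
  because for small \<open>t\<close> the map \<open>x \<mapsto> x - t (p x - y)\<close> is a contraction whose fixed point solves
  \<open>p x = y\<close>.
\<close>

lemma positive_resolvent:
  fixes h :: "('h::complex_hilbert_space) operator"
  assumes h: "op_positive h" and \<epsilon>: "0 < \<epsilon>"
  defines "p \<equiv> h + \<epsilon> *\<^sub>R id_blinfun"
  obtains g where "complex_linear g" "p o\<^sub>L g = id_blinfun" "g o\<^sub>L p = id_blinfun"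
    "\<And>c. c o\<^sub>L h = h o\<^sub>L c \<Longrightarrow> c o\<^sub>L g = g o\<^sub>L c"
proof -
  have p_app: "p x = h x + \<epsilon> *\<^sub>R x" for x
    by (simp add: p_def blinfun.add_left blinfun.scaleR_left)
  have p_cl: "complex_linear p"
    using h by (simp add: p_def op_positive_iff)
  have coercive: "\<epsilon> * (norm x)\<^sup>2 \<le> inner (p x) x" for x
    using h by (auto simp: p_app inner_add_left power2_norm_eq_inner op_positive_iff)
  have below: "\<epsilon> * norm x \<le> norm (p x)" for x
  proof -
    have "(\<epsilon> * norm x) * norm x \<le> norm (p x) * norm x"
      using coercive[of x] norm_cauchy_schwarz[of "p x" x] by (simp add: power2_eq_square)
    then show ?thesis
      by (cases "x = 0") (auto simp: mult_le_cancel_right_pos)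
  qed
  have inj: "x = y" if "p x = p y" for x y
    using below[of "x - y"] that \<epsilon> by (simp add: blinfun.diff_right mult_le_0_iff)
  have surj: "\<exists>x. p x = y" for y
  proof -
    define M where "M = norm p + \<epsilon> + 1"
    have M: "norm p \<le> M" "\<epsilon> < M" "0 < M"
      using \<epsilon> by (auto simp: M_def add_nonneg_pos add_pos_pos)
    \<comment> \<open>The minimiser of the bound \<open>1 - 2 t \<epsilon> + t\<^sup>2 M\<^sup>2\<close> for the squared contraction factor.\<close>
    define t where "t = \<epsilon> / M\<^sup>2"
    have t: "0 < t"
      using \<epsilon> M by (simp add: t_def)
    define c where "c = sqrt (1 - (\<epsilon> / M)\<^sup>2)"
    have "\<epsilon> / M < 1" "0 < \<epsilon> / M"
      using \<epsilon> M by auto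
    then have q: "(\<epsilon> / M)\<^sup>2 < 1" "0 < (\<epsilon> / M)\<^sup>2"
      by (auto simp: power_less_one_iff abs_square_less_1)
    then have c: "0 \<le> c" "c < 1"
      by (auto simp: c_def)
    have contr: "norm (x - t *\<^sub>R p x) \<le> c * norm x" for x
    proof -
      have "norm (p x) \<le> M * norm x"
        using M by (intro order.trans[OF norm_blinfun] mult_right_mono) auto
      then have px: "(norm (p x))\<^sup>2 \<le> M\<^sup>2 * (norm x)\<^sup>2"
        by (metis norm_ge_zero power_mono power_mult_distrib)
      have "(norm (x - t *\<^sub>R p x))\<^sup>2 = (norm x)\<^sup>2 - 2 * t * inner (p x) x + t\<^sup>2 * (norm (p x))\<^sup>2"
        unfolding power2_norm_eq_inner
        by (simp add: inner_simps inner_commute[of x "p x"] power2_eq_square algebra_simps)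
      also have "\<dots> \<le> (norm x)\<^sup>2 - 2 * t * (\<epsilon> * (norm x)\<^sup>2) + t\<^sup>2 * (M\<^sup>2 * (norm x)\<^sup>2)"
        using px coercive[of x] t by (intro add_mono diff_mono mult_left_mono) auto
      also have "\<dots> = (1 - (\<epsilon> / M)\<^sup>2) * (norm x)\<^sup>2"
        using M by (simp add: t_def power2_eq_square field_simps)
      also have "\<dots> = (c * norm x)\<^sup>2"
        using q by (simp add: c_def power_mult_distrib)
      finally show ?thesis
        by (rule power2_le_imp_le) (use c in simp)
    qed
    have "\<exists>!x. x - t *\<^sub>R (p x - y) = x"
    proof (rule banach_fix_type[OF c], intro allI)
      fix u v
      have "(u - t *\<^sub>R (p u - y)) - (v - t *\<^sub>R (p v - y)) = (u - v) - t *\<^sub>R p (u - v)"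
        by (simp add: blinfun.diff_right scaleR_diff_right)
      then show "dist (u - t *\<^sub>R (p u - y)) (v - t *\<^sub>R (p v - y)) \<le> c * dist u v"
        using contr[of "u - v"] unfolding dist_norm by (simp only:)
    qed
    then show ?thesis
      using t by auto
  qed
  then obtain G where G: "\<And>y. p (G y) = y"
    by metis
  have "bounded_linear G"
  proof (rule bounded_linear_intro)
    show "G (x + y) = G x + G y" for x y
      by (rule inj) (simp add: G blinfun.add_right)
    show "G (r *\<^sub>R x) = r *\<^sub>R G x" for r x
      by (rule inj) (simp add: G blinfun.scaleR_right)
    show "norm (G x) \<le> norm x * (1 / \<epsilon>)" for x
      using below[of "G x"] \<epsilon> by (simp add: G field_simps)
  qed
  then have app: "Blinfun G x = G x" for x
    by (simp add: bounded_linear_Blinfun_apply)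
  show ?thesis
  proof
    show "complex_linear (Blinfun G)"
      unfolding complex_linear_def app
      by (intro allI, rule inj) (simp add: G complex_linearD[OF p_cl])
    show "p o\<^sub>L Blinfun G = id_blinfun"
      by (intro blinfun_eqI) (simp add: app G)
    show "Blinfun G o\<^sub>L p = id_blinfun"
      by (rule blinfun_eqI, rule inj) (simp add: app G)
    fix c
    assume "c o\<^sub>L h = h o\<^sub>L c"
    then have "p (c x) = c (p x)" for x
      by (simp add: p_app blinfun.add_right blinfun.scaleR_right)
        (metis blinfun_apply_blinfun_compose)
    then have "p ((c o\<^sub>L Blinfun G) x) = p ((Blinfun G o\<^sub>L c) x)" for x
      by (simp add: app G)
    then show "c o\<^sub>L Blinfun G = Blinfun G o\<^sub>L c"
      using inj by (metis blinfun_eqI)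
  qed
qed

section \<open>Algebras with a tracial state\<close>

locale tracial_algebra =
  fixes A :: "('h::complex_hilbert_space) operator set"
    and \<phi> :: "'h operator \<Rightarrow> complex"
  assumes von_neumann: "von_neumann_algebra A"
    and state: "state_on A \<phi>"
    and tracial: "tracial_on A \<phi>"
begin

lemma complex_linear_mem: "a \<in> A \<Longrightarrow> complex_linear a"
  and op_adj_mem: "a \<in> A \<Longrightarrow> op_adj a \<in> A"
  using von_neumann by (auto simp: von_neumann_algebra_def)

text \<open>
  The closure properties of \<open>A\<close> come from the double commutant: an operator belongs to \<open>A\<close> as soon as
  it commutes with the commutant.
\<close>

lemma mem_iff: "a \<in> A \<longleftrightarrow> complex_linear a \<and> (\<forall>c\<in>commutant A. c o\<^sub>L a = a o\<^sub>L c)"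
proof -
  have "a \<in> A \<longleftrightarrow> a \<in> commutant (commutant A)"
    using von_neumann by (simp add: von_neumann_algebra_def)
  then show ?thesis
    unfolding commutant_def[of "commutant A"] by auto
qed

lemma commute_mem: "c \<in> commutant A \<Longrightarrow> a \<in> A \<Longrightarrow> c o\<^sub>L a = a o\<^sub>L c"
  using mem_iff by blast

lemma id_mem: "id_blinfun \<in> A"
  by (simp add: mem_iff)

lemma add_mem: "a \<in> A \<Longrightarrow> b \<in> A \<Longrightarrow> a + b \<in> A"
  by (simp add: mem_iff compose.add_left compose.add_right)

lemma diff_mem: "a \<in> A \<Longrightarrow> b \<in> A \<Longrightarrow> a - b \<in> A"
  by (simp add: mem_iff compose.diff_left compose.diff_right)

lemma scaleR_mem: "a \<in> A \<Longrightarrow> r *\<^sub>R a \<in> A"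
  by (simp add: mem_iff compose.scaleR_left compose.scaleR_right)

lemma zero_mem: "0 \<in> A"
  using scaleR_mem[OF id_mem, of 0] by simp

lemma sum_mem: "(\<And>i. i \<in> I \<Longrightarrow> f i \<in> A) \<Longrightarrow> sum f I \<in> A"
  by (induction I rule: infinite_finite_induct) (auto simp: zero_mem add_mem)

lemma compose_mem:
  assumes "a \<in> A" "b \<in> A"
  shows "a o\<^sub>L b \<in> A"
proof -
  have "c o\<^sub>L (a o\<^sub>L b) = (a o\<^sub>L b) o\<^sub>L c" if "c \<in> commutant A" for c
    using commute_mem[OF that assms(1)] commute_mem[OF that assms(2)] by (metis compose_assoc)
  then show ?thesis
    using assms by (simp add: mem_iff)
qed

lemma scaleC_mem:
  assumes "a \<in> A"
  shows "op_scaleC z a \<in> A"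
proof -
  have "c o\<^sub>L op_scaleC z a = op_scaleC z a o\<^sub>L c" if c: "c \<in> commutant A" for c
  proof (rule blinfun_eqI)
    fix x
    have "c (a x) = a (c x)"
      using commute_mem[OF c assms] by (metis blinfun_apply_blinfun_compose)
    moreover have "complex_linear c"
      using c by (simp add: commutant_def)
    ultimately show "(c o\<^sub>L op_scaleC z a) x = (op_scaleC z a o\<^sub>L c) x"
      by (simp add: op_scaleC.rep_eq complex_linearD)
  qed
  then show ?thesis
    using assms by (simp add: mem_iff)
qed

lemma op_abs_mem:
  assumes "a \<in> A"
  shows "op_abs a \<in> A"
proof -
  have "op_adj a o\<^sub>L a \<in> A"
    by (intro compose_mem op_adj_mem assms)
  then have "c o\<^sub>L op_abs a = op_abs a o\<^sub>L c" if "c \<in> commutant A" for c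
    using that by (intro op_abs_commute complex_linear_mem assms commute_mem)
  moreover have "complex_linear (op_abs a)"
    using op_abs_positive[OF complex_linear_mem[OF assms]] by (simp add: op_positive_iff)
  ultimately show ?thesis
    by (simp add: mem_iff)
qed

lemma state_add: "a \<in> A \<Longrightarrow> b \<in> A \<Longrightarrow> \<phi> (a + b) = \<phi> a + \<phi> b"
  using state by (simp add: state_on_def)

lemma state_scaleC: "a \<in> A \<Longrightarrow> \<phi> (op_scaleC z a) = z * \<phi> a"
  using state by (simp add: state_on_def)

lemma state_id: "\<phi> id_blinfun = 1"
  using state by (simp add: state_on_def)

lemma state_scaleR:
  assumes "a \<in> A"
  shows "\<phi> (r *\<^sub>R a) = r * \<phi> a"
proof -
  have "r *\<^sub>R a = op_scaleC (complex_of_real r) a"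
    by (rule blinfun_eqI) (simp add: op_scaleC.rep_eq scaleC_of_real blinfun.scaleR_left)
  then show ?thesis
    using state_scaleC[OF assms] by simp
qed

lemma state_diff:
  assumes "a \<in> A" "b \<in> A"
  shows "\<phi> (a - b) = \<phi> a - \<phi> b"
  using state_add[OF diff_mem[OF assms] assms(2)] by simp

lemma state_positive: "a \<in> A \<Longrightarrow> op_positive a \<Longrightarrow> 0 \<le> Re (\<phi> a)"
  and state_positive_real: "a \<in> A \<Longrightarrow> op_positive a \<Longrightarrow> \<phi> a \<in> \<real>"
  using state by (auto simp: state_on_def)

lemma state_commute: "a \<in> A \<Longrightarrow> b \<in> A \<Longrightarrow> \<phi> (a o\<^sub>L b) = \<phi> (b o\<^sub>L a)"
  using tracial by (simp add: tracial_on_def)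

text \<open>A symmetric operator becomes positive after adding a multiple of the identity.\<close>

lemma state_symmetric_real:
  assumes "b \<in> A" and sym: "\<And>x y. inner (b x) y = inner x (b y)"
  shows "\<phi> b \<in> \<real>"
proof -
  define c where "c = b + norm b *\<^sub>R id_blinfun"
  have "0 \<le> inner (c x) x" for x
  proof -
    have "- inner (b x) x \<le> norm (b x) * norm x"
      using norm_cauchy_schwarz[of "- b x" x] by simp
    also have "\<dots> \<le> (norm b * norm x) * norm x"
      by (intro mult_right_mono norm_blinfun) simp
    finally show ?thesis
      by (simp add: c_def blinfun.add_left blinfun.scaleR_left inner_add_left dot_square_norm
          power2_eq_square algebra_simps)
  qed
  moreover have "inner (c x) y = inner x (c y)" for x y
    by (simp add: c_def blinfun.add_left blinfun.scaleR_left inner_add_left inner_add_right sym)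
  moreover have "c \<in> A"
    unfolding c_def by (intro add_mem scaleR_mem id_mem assms)
  ultimately have "\<phi> c \<in> \<real>"
    using complex_linear_mem by (intro state_positive_real) (simp_all add: op_positive_iff)
  moreover have "\<phi> c = \<phi> b + norm b"
    unfolding c_def using assms(1)
    by (simp add: state_add state_scaleR scaleR_mem id_mem state_id)
  ultimately show ?thesis
    by (simp add: complex_is_Real_iff)
qed

lemma Re_state_adj:
  assumes a: "a \<in> A"
  shows "Re (\<phi> (op_adj a)) = Re (\<phi> a)"
proof -
  \<comment> \<open>This operator is symmetric, and the imaginary part of its mean is the difference in question.\<close>
  define b where "b = op_scaleC \<i> (a - op_adj a)"
  have cl: "complex_linear a"
    using a by (rule complex_linear_mem)
  have b: "b \<in> A"
    unfolding b_def using a by (intro scaleC_mem diff_mem op_adj_mem)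
  have minus: "(- \<i>) *\<^sub>C u = - (\<i> *\<^sub>C u)" for u :: 'h
    using scaleC_scaleC[of "\<i>" "of_real (-1)" u] scaleC_of_real[of "-1" u]
    by (simp add: scaleC_minus_right)
  have "inner (b x) y = inner x (b y)" for x y
    using cl
    by (simp add: b_def op_scaleC.rep_eq blinfun.diff_left inner_scaleC_left inner_diff_left
        inner_op_adj inner_op_adj' complex_linearD minus blinfun.minus_right scaleC_diff_right
        inner_diff_right op_adj_adj)
  then have "\<phi> b \<in> \<real>"
    by (rule state_symmetric_real[OF b])
  moreover have "\<phi> b = \<i> * (\<phi> a - \<phi> (op_adj a))"
    unfolding b_def using a by (simp add: state_scaleC state_diff diff_mem op_adj_mem)
  ultimately show ?thesis
    by (simp add: complex_is_Real_iff)
qed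

text \<open>
  With \<open>h = k\<^sup>2\<close>, expand \<open>\<phi> (q* q) \<ge> 0\<close> for \<open>q = k w* - k\<close>: the two mixed terms are adjoint to each other
  with real part \<open>Re \<phi> (w h)\<close>, and by traciality \<open>\<phi> (w k k w*) = \<phi> (k w* w k) \<le> \<phi> (k k)\<close>.
\<close>

lemma Re_state_contraction_le:
  assumes w: "w \<in> A" and contr: "\<And>x. norm (w x) \<le> norm x"
    and h: "h \<in> A" "op_positive h"
  shows "Re (\<phi> (w o\<^sub>L h)) \<le> Re (\<phi> h)"
proof -
  obtain k where k_pos: "op_positive k" and kk: "k o\<^sub>L k = h"
    and k_comm: "\<forall>c. c o\<^sub>L h = h o\<^sub>L c \<longrightarrow> c o\<^sub>L k = k o\<^sub>L c"
    using op_positive_sqrt_exists[OF h(2)] by (elim exE conjE) (rule that)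
  have k_cl: "complex_linear k" and k_sym: "\<And>x y. inner (k x) y = inner x (k y)"
    using k_pos by (auto simp: op_positive_iff)
  have k: "k \<in> A"
    using k_cl k_comm commute_mem[OF _ h(1)] by (simp add: mem_iff)
  have w_cl: "complex_linear w"
    using w by (rule complex_linear_mem)
  have adj_k: "op_adj k = k"
    using k_pos by (rule op_positive_self_adjoint)
  let ?w' = "op_adj w"
  have w': "?w' \<in> A"
    using w by (rule op_adj_mem)
  define q where "q = (k o\<^sub>L ?w') - k"
  have q: "q \<in> A"
    unfolding q_def by (intro diff_mem compose_mem k w')
  have adj_q: "op_adj q = (w o\<^sub>L k) - k"
    using w_cl k_cl k_sym
    by (intro op_adj_eqI)
      (simp_all add: q_def blinfun.diff_left inner_diff_left inner_diff_right inner_op_adj')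
  have "(op_adj q o\<^sub>L q) = ((w o\<^sub>L k) o\<^sub>L (k o\<^sub>L ?w')) - (w o\<^sub>L h) - ((k o\<^sub>L (k o\<^sub>L ?w')) - h)"
    unfolding adj_q
    by (simp add: q_def compose.diff_left compose.diff_right compose_assoc kk algebra_simps)
  then have expand: "Re (\<phi> (op_adj q o\<^sub>L q)) = Re (\<phi> ((w o\<^sub>L k) o\<^sub>L (k o\<^sub>L ?w'))) - Re (\<phi> (w o\<^sub>L h))
      - (Re (\<phi> (k o\<^sub>L (k o\<^sub>L ?w'))) - Re (\<phi> h))"
    by (simp add: state_diff diff_mem compose_mem w w' k h)
  have "k o\<^sub>L (k o\<^sub>L ?w') = op_adj (w o\<^sub>L h)"
    using w_cl h op_positive_self_adjoint[OF h(2)]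
    by (simp add: op_adj_compose complex_linear_mem compose_assoc[symmetric] kk)
  then have mixed: "Re (\<phi> (k o\<^sub>L (k o\<^sub>L ?w'))) = Re (\<phi> (w o\<^sub>L h))"
    by (simp add: Re_state_adj compose_mem w h)
  \<comment> \<open>The operator \<open>k (1 - w* w) k\<close>, positive because \<open>w\<close> is a contraction.\<close>
  define d where "d = h - ((k o\<^sub>L ?w') o\<^sub>L (w o\<^sub>L k))"
  have d: "d \<in> A"
    unfolding d_def by (intro diff_mem compose_mem k w w' h)
  have d_inner: "inner (d x) y = inner (k x) (k y) - inner (w (k x)) (w (k y))" for x y
    using w_cl kk[symmetric]
    by (simp add: d_def blinfun.diff_left inner_diff_left k_sym inner_op_adj inner_op_adj' op_adj_adj)
  have "inner (d x) y = inner x (d y)" for x y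
    by (metis d_inner inner_commute)
  moreover have "0 \<le> inner (d x) x" for x
    using power_mono[OF contr[of "k x"], of 2]
    by (simp add: d_inner dot_square_norm)
  ultimately have "op_positive d"
    using complex_linear_mem[OF d] by (simp add: op_positive_iff)
  then have "0 \<le> Re (\<phi> d)"
    using d by (intro state_positive)
  moreover have "\<phi> d = \<phi> h - \<phi> ((w o\<^sub>L k) o\<^sub>L (k o\<^sub>L ?w'))"
    unfolding d_def
    by (simp add: state_diff compose_mem w w' k h state_commute[of "k o\<^sub>L ?w'" "w o\<^sub>L k"])
  moreover have "0 \<le> Re (\<phi> (op_adj q o\<^sub>L q))"
    using q by (intro state_positive op_positive_adj_compose compose_mem op_adj_mem)
      (auto intro: complex_linear_mem)
  ultimately show ?thesis
    using expand mixed by simp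
qed


section \<open>The triangle inequality for the trace norm\<close>

text \<open>
  A substitute for the polar decomposition: \<open>v = a (\<bar>a\<bar> + \<epsilon>)\<^sup>-\<^sup>1\<close> is a contraction in \<open>A\<close> with
  \<open>a = v (\<bar>a\<bar> + \<epsilon>)\<close>, and \<open>v* a\<close> differs from \<open>\<bar>a\<bar>\<close> by \<open>\<epsilon>\<close> times a contraction.
\<close>

lemma approximate_polar_decomposition:
  assumes a: "a \<in> A" and \<epsilon>: "0 < \<epsilon>"
  obtains v w where "v \<in> A" "\<And>x. norm (v x) \<le> norm x" "w \<in> A" "\<And>x. norm (w x) \<le> norm x"
    "a = v o\<^sub>L (op_abs a + \<epsilon> *\<^sub>R id_blinfun)" "op_adj v o\<^sub>L a = op_abs a - \<epsilon> *\<^sub>R w"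
proof -
  define h where "h = op_abs a"
  define p where "p = h + \<epsilon> *\<^sub>R id_blinfun"
  have a_cl: "complex_linear a"
    using a by (rule complex_linear_mem)
  have h_pos: "op_positive h" and hh: "h o\<^sub>L h = op_adj a o\<^sub>L a"
    unfolding h_def using a_cl by (rule op_abs_positive op_abs_square)+
  have h_sym: "inner (h x) y = inner x (h y)" and h_nonneg: "0 \<le> inner (h x) x" for x y
    using h_pos by (auto simp: op_positive_iff)
  have h: "h \<in> A"
    unfolding h_def using a by (rule op_abs_mem)
  obtain g where g_cl: "complex_linear g" and pg: "p o\<^sub>L g = id_blinfun"
    and gp: "g o\<^sub>L p = id_blinfun" and g_comm: "\<And>c. c o\<^sub>L h = h o\<^sub>L c \<Longrightarrow> c o\<^sub>L g = g o\<^sub>L c"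
    by (rule positive_resolvent[OF h_pos \<epsilon>, folded p_def]) (rule that)
  have g: "g \<in> A"
    using g_cl g_comm commute_mem[OF _ h] by (simp add: mem_iff)
  have p_app: "p x = h x + \<epsilon> *\<^sub>R x" for x
    by (simp add: p_def blinfun.add_left blinfun.scaleR_left)
  have p_sym: "inner (p x) y = inner x (p y)" for x y
    by (simp add: p_app inner_add_left inner_add_right h_sym)
  have pg_app: "p (g x) = x" for x
    using pg by (metis blinfun_apply_blinfun_compose blinfun_apply_id_blinfun id_apply)
  have "inner (g x) y = inner x (g y)" for x y
    using p_sym[of "g x" "g y"] by (simp add: pg_app)
  then have adj_g: "op_adj g = g"
    by (intro op_adj_eqI g_cl)
  have "norm (h x) \<le> norm (p x)" for x
  proof (rule power2_le_imp_le)
    have "(norm (p x))\<^sup>2 = (norm (h x))\<^sup>2 + 2 * \<epsilon> * inner (h x) x + \<epsilon>\<^sup>2 * (norm x)\<^sup>2"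
      unfolding power2_norm_eq_inner p_app
      by (simp add: inner_add_left inner_add_right inner_commute[of x "h x"] power2_eq_square
          algebra_simps)
    then show "(norm (h x))\<^sup>2 \<le> (norm (p x))\<^sup>2"
      using h_nonneg[of x] \<epsilon> by simp
  qed simp
  from this[of "g _"] have hg: "norm (h (g x)) \<le> norm x" for x
    by (simp add: pg_app)
  show ?thesis
  proof
    show "a o\<^sub>L g \<in> A" "h o\<^sub>L g \<in> A"
      by (intro compose_mem a g h)+
    show "norm ((a o\<^sub>L g) x) \<le> norm x" for x
      using hg[of x] norm_op_abs_apply[OF a_cl, of "g x"] by (simp add: h_def)
    show "norm ((h o\<^sub>L g) x) \<le> norm x" for x
      using hg by simp
    show "a = (a o\<^sub>L g) o\<^sub>L (op_abs a + \<epsilon> *\<^sub>R id_blinfun)"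
      using gp by (simp add: compose_assoc p_def h_def)
    have "h o\<^sub>L g = g o\<^sub>L h"
      by (rule g_comm) simp
    then have gh: "g o\<^sub>L h = id_blinfun - \<epsilon> *\<^sub>R g"
      using pg by (simp add: p_def compose.add_left compose.scaleR_left algebra_simps)
    have "op_adj (a o\<^sub>L g) o\<^sub>L a = g o\<^sub>L (h o\<^sub>L h)"
      using a_cl g_cl by (simp add: op_adj_compose adj_g compose_assoc hh)
    also have "\<dots> = (g o\<^sub>L h) o\<^sub>L h"
      by (simp add: compose_assoc)
    also have "\<dots> = h - \<epsilon> *\<^sub>R (g o\<^sub>L h)"
      by (simp add: gh compose.diff_left compose.scaleR_left)
    also have "\<dots> = op_abs a - \<epsilon> *\<^sub>R (h o\<^sub>L g)"
      unfolding h_def[symmetric] \<open>h o\<^sub>L g = g o\<^sub>L h\<close> ..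
    finally show "op_adj (a o\<^sub>L g) o\<^sub>L a = op_abs a - \<epsilon> *\<^sub>R (h o\<^sub>L g)" .
  qed
qed

text \<open>
  The next two lemmas say that \<open>norm1 \<phi> a\<close> is the supremum of \<open>Re \<phi> (u a)\<close> over the contractions \<open>u\<close>
  in \<open>A\<close>; this makes \<open>norm1 \<phi>\<close> subadditive.
\<close>

lemma Re_state_le_norm1:
  assumes a: "a \<in> A" and u: "u \<in> A" "\<And>x. norm (u x) \<le> norm x"
  shows "Re (\<phi> (u o\<^sub>L a)) \<le> norm1 \<phi> a"
proof (rule field_le_epsilon)
  fix \<epsilon> :: real
  assume \<epsilon>: "0 < \<epsilon>"
  let ?p = "op_abs a + \<epsilon> *\<^sub>R id_blinfun"
  obtain v where v: "v \<in> A" "\<And>x. norm (v x) \<le> norm x" and eq: "a = v o\<^sub>L ?p"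
    using approximate_polar_decomposition[OF a \<epsilon>] by metis
  have p: "?p \<in> A"
    by (intro add_mem scaleR_mem id_mem op_abs_mem a)
  have p_pos: "op_positive ?p"
    using \<epsilon> op_abs_positive[OF complex_linear_mem[OF a]]
    by (intro op_positive_add op_positive_scaleR) auto
  have "u o\<^sub>L a = (u o\<^sub>L v) o\<^sub>L ?p"
    by (subst eq) (simp add: compose_assoc)
  also have "Re (\<phi> \<dots>) \<le> Re (\<phi> ?p)"
    using u v p p_pos order.trans[OF u(2) v(2)]
    by (intro Re_state_contraction_le compose_mem) auto
  also have "Re (\<phi> ?p) = norm1 \<phi> a + \<epsilon>"
    by (simp add: norm1_def state_add state_scaleR state_id scaleR_mem id_mem op_abs_mem a)
  finally show "Re (\<phi> (u o\<^sub>L a)) \<le> norm1 \<phi> a + \<epsilon>" .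
qed

lemma norm1_almost_attained:
  assumes a: "a \<in> A" and \<epsilon>: "0 < \<epsilon>"
  obtains u where "u \<in> A" "\<And>x. norm (u x) \<le> norm x" "norm1 \<phi> a \<le> Re (\<phi> (u o\<^sub>L a)) + \<epsilon>"
proof -
  obtain v w where v: "v \<in> A" "\<And>x. norm (v x) \<le> norm x"
    and w: "w \<in> A" "\<And>x. norm (w x) \<le> norm x"
    and eq: "op_adj v o\<^sub>L a = op_abs a - \<epsilon> *\<^sub>R w"
    using approximate_polar_decomposition[OF a \<epsilon>] by metis
  have "Re (\<phi> (w o\<^sub>L id_blinfun)) \<le> Re (\<phi> id_blinfun)"
    using w by (intro Re_state_contraction_le id_mem) auto
  then have "\<epsilon> * Re (\<phi> w) \<le> \<epsilon> * 1"
    using \<epsilon> by (intro mult_left_mono) (auto simp: state_id)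
  moreover have "Re (\<phi> (op_adj v o\<^sub>L a)) = norm1 \<phi> a - \<epsilon> * Re (\<phi> w)"
    unfolding eq by (simp add: norm1_def state_diff state_scaleR scaleR_mem op_abs_mem a w)
  ultimately show ?thesis
    using v by (intro that[of "op_adj v"] op_adj_mem norm_op_adj_contraction)
      (auto intro: complex_linear_mem)
qed

lemma norm1_triangle:
  assumes a: "a \<in> A" and b: "b \<in> A"
  shows "norm1 \<phi> (a + b) \<le> norm1 \<phi> a + norm1 \<phi> b"
proof (rule field_le_epsilon)
  fix \<epsilon> :: real
  assume \<epsilon>: "0 < \<epsilon>"
  obtain u where u: "u \<in> A" "\<And>x. norm (u x) \<le> norm x"
    and le: "norm1 \<phi> (a + b) \<le> Re (\<phi> (u o\<^sub>L (a + b))) + \<epsilon>"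
    using norm1_almost_attained[OF add_mem[OF a b] \<epsilon>] by metis
  have "Re (\<phi> (u o\<^sub>L (a + b))) = Re (\<phi> (u o\<^sub>L a)) + Re (\<phi> (u o\<^sub>L b))"
    by (simp add: compose.add_right state_add compose_mem u a b)
  then show "norm1 \<phi> (a + b) \<le> norm1 \<phi> a + norm1 \<phi> b + \<epsilon>"
    using le Re_state_le_norm1[OF a u] Re_state_le_norm1[OF b u] by linarith
qed

lemma norm1_nonneg: "a \<in> A \<Longrightarrow> 0 \<le> norm1 \<phi> a"
  unfolding norm1_def
  by (intro state_positive op_abs_mem op_abs_positive complex_linear_mem)

lemma norm1_scaleR: "a \<in> A \<Longrightarrow> norm1 \<phi> (r *\<^sub>R a) = \<bar>r\<bar> * norm1 \<phi> a"
  by (simp add: norm1_def op_abs_scaleR complex_linear_mem state_scaleR op_abs_mem)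

lemma norm1_0: "norm1 \<phi> 0 = 0"
  using norm1_scaleR[OF id_mem, of 0] by simp

lemma norm1_of_positive: "op_positive h \<Longrightarrow> norm1 \<phi> h = Re (\<phi> h)"
  by (simp add: norm1_def op_abs_of_positive)

lemma norm1_minus_commute: "a \<in> A \<Longrightarrow> b \<in> A \<Longrightarrow> norm1 \<phi> (a - b) = norm1 \<phi> (b - a)"
  using norm1_scaleR[OF diff_mem, of b a "-1"] by simp

lemma norm1_dist_triangle:
  "a \<in> A \<Longrightarrow> b \<in> A \<Longrightarrow> c \<in> A \<Longrightarrow> norm1 \<phi> (a - c) \<le> norm1 \<phi> (a - b) + norm1 \<phi> (b - c)"
  using norm1_triangle[OF diff_mem diff_mem, of a b b c] by simp

lemma norm1_sum_le:
  "(\<And>i. i \<in> I \<Longrightarrow> f i \<in> A) \<Longrightarrow> norm1 \<phi> (sum f I) \<le> (\<Sum>i\<in>I. norm1 \<phi> (f i))"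
proof (induction I rule: infinite_finite_induct)
  case (insert i I)
  then show ?case
    using norm1_triangle[of "f i" "sum f I"] by (auto simp: sum_mem)
qed (simp_all add: norm1_0)

end

section \<open>The completion in the trace norm\<close>

context tracial_algebra
begin

lemma L1_Cauchy_mem: "u \<in> L1_Cauchy A \<phi> \<Longrightarrow> u n \<in> A"
  by (simp add: L1_Cauchy_def)

lemma L1_Cauchy_const: "a \<in> A \<Longrightarrow> (\<lambda>_. a) \<in> L1_Cauchy A \<phi>"
  by (auto simp: L1_Cauchy_def norm1_0)

lemma norm1_abs_diff_le:
  assumes "a \<in> A" "b \<in> A"
  shows "\<bar>norm1 \<phi> a - norm1 \<phi> b\<bar> \<le> norm1 \<phi> (a - b)"
  using norm1_triangle[OF diff_mem[OF assms] assms(2)]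
    norm1_triangle[OF diff_mem[OF assms(2,1)] assms(1)] norm1_minus_commute[OF assms]
  by simp

lemma norm1_diff_diff_le:
  assumes "a \<in> A" "b \<in> A" "c \<in> A" "d \<in> A"
  shows "\<bar>norm1 \<phi> (a - b) - norm1 \<phi> (c - d)\<bar> \<le> norm1 \<phi> (a - c) + norm1 \<phi> (b - d)"
proof -
  have "\<bar>norm1 \<phi> (a - b) - norm1 \<phi> (c - d)\<bar> \<le> norm1 \<phi> ((a - b) - (c - d))"
    by (intro norm1_abs_diff_le diff_mem assms)
  also have "(a - b) - (c - d) = (a - c) + (d - b)"
    by simp
  also have "norm1 \<phi> \<dots> \<le> norm1 \<phi> (a - c) + norm1 \<phi> (d - b)"
    by (intro norm1_triangle diff_mem assms)
  also have "norm1 \<phi> (d - b) = norm1 \<phi> (b - d)"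
    by (intro norm1_minus_commute assms)
  finally show ?thesis .
qed

lemma norm1_diff_convergent:
  assumes u: "u \<in> L1_Cauchy A \<phi>" and v: "v \<in> L1_Cauchy A \<phi>"
  shows "convergent (\<lambda>n. norm1 \<phi> (u n - v n))"
  unfolding Cauchy_convergent_iff[symmetric]
proof (rule CauchyI)
  fix e :: real
  assume "0 < e"
  then have "0 < e / 2"
    by simp
  then obtain M N where M: "\<forall>m\<ge>M. \<forall>n\<ge>M. norm1 \<phi> (u m - u n) < e / 2"
    and N: "\<forall>m\<ge>N. \<forall>n\<ge>N. norm1 \<phi> (v m - v n) < e / 2"
    using u v unfolding L1_Cauchy_def mem_Collect_eq by meson
  show "\<exists>M. \<forall>m\<ge>M. \<forall>n\<ge>M. norm (norm1 \<phi> (u m - v m) - norm1 \<phi> (u n - v n)) < e"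
  proof (intro exI allI impI)
    fix m n
    assume "max M N \<le> m" "max M N \<le> n"
    then have "norm1 \<phi> (u m - u n) < e / 2" "norm1 \<phi> (v m - v n) < e / 2"
      using M N by auto
    then show "norm (norm1 \<phi> (u m - v m) - norm1 \<phi> (u n - v n)) < e"
      using norm1_diff_diff_le[of "u m" "v m" "u n" "v n"] u v
      by (simp add: L1_Cauchy_mem)
  qed
qed

lemma equiv_L1_rel: "equiv (L1_Cauchy A \<phi>) (L1_rel A \<phi>)"
proof (rule equivI)
  show "L1_rel A \<phi> \<subseteq> L1_Cauchy A \<phi> \<times> L1_Cauchy A \<phi>"
    by (auto simp: L1_rel_def)
  show "refl_on (L1_Cauchy A \<phi>) (L1_rel A \<phi>)"
    by (auto simp: refl_on_def L1_rel_def norm1_0)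
  show "sym (L1_rel A \<phi>)"
  proof (rule symI)
    fix u v
    assume "(u, v) \<in> L1_rel A \<phi>"
    moreover from this have "norm1 \<phi> (u n - v n) = norm1 \<phi> (v n - u n)" for n
      by (intro norm1_minus_commute) (auto simp: L1_rel_def intro: L1_Cauchy_mem)
    ultimately show "(v, u) \<in> L1_rel A \<phi>"
      by (simp add: L1_rel_def)
  qed
  show "trans (L1_rel A \<phi>)"
  proof (rule transI)
    fix u v w
    assume "(u, v) \<in> L1_rel A \<phi>" "(v, w) \<in> L1_rel A \<phi>"
    then have mem: "u \<in> L1_Cauchy A \<phi>" "v \<in> L1_Cauchy A \<phi>" "w \<in> L1_Cauchy A \<phi>"
      and lim: "(\<lambda>n. norm1 \<phi> (u n - v n)) \<longlonglongrightarrow> 0" "(\<lambda>n. norm1 \<phi> (v n - w n)) \<longlonglongrightarrow> 0"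
      by (auto simp: L1_rel_def)
    have "(\<lambda>n. norm1 \<phi> (u n - w n)) \<longlonglongrightarrow> 0"
    proof (rule tendsto_sandwich[OF _ _ tendsto_const])
      show "(\<lambda>n. norm1 \<phi> (u n - v n) + norm1 \<phi> (v n - w n)) \<longlonglongrightarrow> 0"
        using tendsto_add[OF lim] by simp
    qed (use mem in \<open>auto intro!: always_eventually norm1_nonneg norm1_dist_triangle diff_mem
        intro: L1_Cauchy_mem\<close>)
    with mem show "(u, w) \<in> L1_rel A \<phi>"
      by (simp add: L1_rel_def)
  qed
qed

lemma L1_spaceI: "u \<in> L1_Cauchy A \<phi> \<Longrightarrow> L1_rel A \<phi> `` {u} \<in> L1_space A \<phi>"
  unfolding L1_space_def by (rule quotientI)

lemma L1_spaceE:
  assumes "\<xi> \<in> L1_space A \<phi>"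
  obtains u where "u \<in> L1_Cauchy A \<phi>" "\<xi> = L1_rel A \<phi> `` {u}"
  using assms unfolding L1_space_def by (rule quotientE)

lemma L1_class_eqI:
  assumes "u \<in> L1_Cauchy A \<phi>" "v \<in> L1_Cauchy A \<phi>" "(\<lambda>n. norm1 \<phi> (u n - v n)) \<longlonglongrightarrow> 0"
  shows "L1_rel A \<phi> `` {u} = L1_rel A \<phi> `` {v}"
  using assms by (intro equiv_class_eq[OF equiv_L1_rel]) (simp add: L1_rel_def)

lemma L1_class_self: "u \<in> L1_Cauchy A \<phi> \<Longrightarrow> u \<in> L1_rel A \<phi> `` {u}"
  by (rule equiv_class_self[OF equiv_L1_rel])

text \<open>
  The distance is a definite description over all representatives. It is meaningful because the
  limit exists along one pair of representatives and changing the pair alters the terms by a null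
  sequence; the same holds for the norm.
\<close>

lemma tendsto_L1_dist:
  assumes u: "u \<in> L1_Cauchy A \<phi>" and v: "v \<in> L1_Cauchy A \<phi>"
  shows "(\<lambda>n. norm1 \<phi> (u n - v n)) \<longlonglongrightarrow> L1_dist \<phi> (L1_rel A \<phi> `` {u}) (L1_rel A \<phi> `` {v})"
proof -
  obtain r where r: "(\<lambda>n. norm1 \<phi> (u n - v n)) \<longlonglongrightarrow> r"
    using norm1_diff_convergent[OF u v] by (auto simp: convergent_def)
  have "(\<lambda>n. norm1 \<phi> (u' n - v' n)) \<longlonglongrightarrow> r"
    if "u' \<in> L1_rel A \<phi> `` {u}" "v' \<in> L1_rel A \<phi> `` {v}" for u' v'
  proof -
    have mem: "u' \<in> L1_Cauchy A \<phi>" "v' \<in> L1_Cauchy A \<phi>"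
      and lim: "(\<lambda>n. norm1 \<phi> (u n - u' n)) \<longlonglongrightarrow> 0" "(\<lambda>n. norm1 \<phi> (v n - v' n)) \<longlonglongrightarrow> 0"
      using that by (auto simp: L1_rel_def)
    have "(\<lambda>n. norm1 \<phi> (u n - v n) - norm1 \<phi> (u' n - v' n)) \<longlonglongrightarrow> 0"
    proof (rule tendsto_rabs_zero_cancel, rule tendsto_sandwich[OF _ _ tendsto_const])
      show "(\<lambda>n. norm1 \<phi> (u n - u' n) + norm1 \<phi> (v n - v' n)) \<longlonglongrightarrow> 0"
        using tendsto_add[OF lim] by simp
    qed (use mem u v in \<open>auto intro!: always_eventually norm1_diff_diff_le intro: L1_Cauchy_mem\<close>)
    from tendsto_diff[OF r this] show ?thesis
      by simp
  qed
  moreover have "r' = r" if "\<forall>u'\<in>L1_rel A \<phi> `` {u}. \<forall>v'\<in>L1_rel A \<phi> `` {v}.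
      (\<lambda>n. norm1 \<phi> (u' n - v' n)) \<longlonglongrightarrow> r'" for r'
    using that L1_class_self[OF u] L1_class_self[OF v] LIMSEQ_unique[OF _ r] by blast
  ultimately have "L1_dist \<phi> (L1_rel A \<phi> `` {u}) (L1_rel A \<phi> `` {v}) = r"
    unfolding L1_dist_def by (intro the_equality) blast+
  with r show ?thesis by simp
qed

lemma L1_dist_triangle:
  assumes "u \<in> L1_Cauchy A \<phi>" "v \<in> L1_Cauchy A \<phi>" "w \<in> L1_Cauchy A \<phi>"
  shows "L1_dist \<phi> (L1_rel A \<phi> `` {v}) (L1_rel A \<phi> `` {w})
    \<le> L1_dist \<phi> (L1_rel A \<phi> `` {u}) (L1_rel A \<phi> `` {v})
      + L1_dist \<phi> (L1_rel A \<phi> `` {u}) (L1_rel A \<phi> `` {w})"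
proof (rule LIMSEQ_le[OF tendsto_L1_dist tendsto_add[OF tendsto_L1_dist tendsto_L1_dist]])
  have "norm1 \<phi> (v n - w n) \<le> norm1 \<phi> (u n - v n) + norm1 \<phi> (u n - w n)" for n
    using norm1_dist_triangle[of "v n" "u n" "w n"] norm1_minus_commute[of "u n" "v n"]
      assms[THEN L1_Cauchy_mem] by simp
  then show "\<exists>N. \<forall>n\<ge>N. norm1 \<phi> (v n - w n) \<le> norm1 \<phi> (u n - v n) + norm1 \<phi> (u n - w n)"
    by blast
qed (use assms in auto)

lemma tendsto_L1_norm:
  assumes u: "u \<in> L1_Cauchy A \<phi>"
  shows "(\<lambda>n. norm1 \<phi> (u n)) \<longlonglongrightarrow> L1_norm \<phi> (L1_rel A \<phi> `` {u})"
proof -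
  obtain r where r: "(\<lambda>n. norm1 \<phi> (u n)) \<longlonglongrightarrow> r"
    using norm1_diff_convergent[OF u L1_Cauchy_const[OF zero_mem]] by (auto simp: convergent_def)
  have "(\<lambda>n. norm1 \<phi> (v n)) \<longlonglongrightarrow> r" if "v \<in> L1_rel A \<phi> `` {u}" for v
  proof -
    have v: "v \<in> L1_Cauchy A \<phi>" and lim: "(\<lambda>n. norm1 \<phi> (u n - v n)) \<longlonglongrightarrow> 0"
      using that by (auto simp: L1_rel_def)
    have "(\<lambda>n. norm1 \<phi> (u n) - norm1 \<phi> (v n)) \<longlonglongrightarrow> 0"
      by (rule tendsto_rabs_zero_cancel, rule tendsto_sandwich[OF _ _ tendsto_const lim])
        (use u v in \<open>auto intro!: always_eventually norm1_abs_diff_le intro: L1_Cauchy_mem\<close>)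
    from tendsto_diff[OF r this] show ?thesis
      by simp
  qed
  moreover have "r' = r" if "\<forall>v\<in>L1_rel A \<phi> `` {u}. (\<lambda>n. norm1 \<phi> (v n)) \<longlonglongrightarrow> r'" for r'
    using that L1_class_self[OF u] LIMSEQ_unique[OF _ r] by blast
  ultimately have "L1_norm \<phi> (L1_rel A \<phi> `` {u}) = r"
    unfolding L1_norm_def by (intro the_equality) blast+
  with r show ?thesis by simp
qed

end


section \<open>Simple functions on the line\<close>

lemma finite_borel_sets_empty: "{} \<in> finite_borel_sets"
  by (simp add: finite_borel_sets_def)

lemma finite_borel_sets_Un:
  assumes "E \<in> finite_borel_sets" "F \<in> finite_borel_sets"
  shows "E \<union> F \<in> finite_borel_sets"
proof -
  have "emeasure lborel (E \<union> F) \<le> emeasure lborel E + emeasure lborel F"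
    using assms by (intro emeasure_subadditive) (simp_all add: finite_borel_sets_def)
  also have "\<dots> < \<infinity>"
    using assms by (simp add: finite_borel_sets_def)
  finally show ?thesis
    using assms by (auto simp: finite_borel_sets_def)
qed

lemma finite_borel_sets_subset:
  assumes "E \<in> finite_borel_sets" "F \<in> sets borel" "F \<subseteq> E"
  shows "F \<in> finite_borel_sets"
proof -
  have "emeasure lborel F \<le> emeasure lborel E"
    using assms by (intro emeasure_mono) (simp_all add: finite_borel_sets_def)
  also have "\<dots> < \<infinity>"
    using assms by (simp add: finite_borel_sets_def)
  finally show ?thesis
    using assms(2) by (simp add: finite_borel_sets_def)
qed

lemma integrable_indicator_finite_borel:
  "E \<in> finite_borel_sets \<Longrightarrow> integrable lborel (indicator E :: real \<Rightarrow> real)"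
  by (simp add: finite_borel_sets_def)

lemma integrable_sum_indicator:
  assumes "\<And>i. i \<in> I \<Longrightarrow> G i \<in> finite_borel_sets"
  shows "integrable lborel (\<lambda>x. \<Sum>i\<in>I. c i * indicator (G i) x :: real)"
  using assms by (intro Bochner_Integration.integrable_sum integrable_mult_right
      integrable_indicator_finite_borel)

lemma simple_fun_integrable: "simple_fun s \<Longrightarrow> integrable lborel s"
  unfolding simple_fun_def simple_repr_def
  by (elim exE conjE) (simp only:, rule integrable_sum_indicator, simp)

lemma simple_fun_integrable_lebesgue: "simple_fun s \<Longrightarrow> integrable lebesgue s"
  using simple_fun_integrable[of s] by (simp add: integrable_completion borel_measurable_integrable)

lemma simple_fun_of_simple_function:
  fixes s :: "real \<Rightarrow> real"
  assumes s: "simple_function lborel s" and int: "integrable lborel s"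
  shows "simple_fun s"
proof -
  define Y where "Y = range s - {0}"
  have "finite Y"
    using simple_functionD(1)[OF s] by (simp add: Y_def)
  then obtain y where y: "bij_betw y {0..<card Y} Y"
    using ex_bij_betw_nat_finite by blast
  have "s -` {v} \<in> finite_borel_sets" if "v \<in> Y" for v
  proof -
    have meas: "s -` {v} \<in> sets borel"
      using simple_functionD(2)[OF s, of "{v}"] by simp
    have "integrable lborel (\<lambda>x. s x / v)"
      using int by simp
    then have "integrable lborel (indicator (s -` {v}) :: real \<Rightarrow> real)"
      by (rule Bochner_Integration.integrable_bound)
        (use meas that in \<open>auto simp: indicator_def Y_def\<close>)
    with meas show ?thesis
      by (simp add: finite_borel_sets_def integrable_indicator_iff)
  qed
  moreover have "y i \<in> Y" if "i < card Y" for i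
    using y that by (auto simp: bij_betw_def)
  moreover have "disjoint_family_on (\<lambda>i. s -` {y i}) {..<card Y}"
    using y by (auto simp: disjoint_family_on_def bij_betw_def inj_on_def)
  moreover have "s x = (\<Sum>i<card Y. y i * indicator (s -` {y i}) x)" for x
  proof -
    have "(\<Sum>i<card Y. y i * indicator (s -` {y i}) x) = (\<Sum>v\<in>Y. v * indicator (s -` {v}) x)"
      using y by (intro sum.reindex_bij_betw) (simp add: atLeast0LessThan)
    also have "\<dots> = (\<Sum>v\<in>Y. if s x = v then v else 0)"
      by (intro sum.cong) (auto simp: indicator_def)
    also have "\<dots> = s x"
      using \<open>finite Y\<close> by (auto simp: Y_def)
    finally show ?thesis ..
  qed
  ultimately have "simple_repr s (card Y) y (\<lambda>i. s -` {y i})"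
    unfolding simple_repr_def by (intro conjI allI impI ext) simp_all
  then show ?thesis
    unfolding simple_fun_def by (intro exI)
qed

text \<open>
  The sets \<open>G i\<close> cut the line into the atoms on which the set of indices \<open>i\<close> with \<open>x \<in> G i\<close> is
  constant. Rewriting over atoms turns combinations of arbitrary sets into combinations of disjoint
  ones, so that neither the choice of a representation nor the difference of two simple functions
  needs separate treatment.
\<close>

definition atom :: "'i set \<Rightarrow> ('i \<Rightarrow> real set) \<Rightarrow> 'i set \<Rightarrow> real set" where
  "atom I G S = {x. {i\<in>I. x \<in> G i} = S}"

lemma atom_finite_borel:
  assumes I: "finite I" and G: "\<And>i. i \<in> I \<Longrightarrow> G i \<in> finite_borel_sets"
    and S: "S \<in> Pow I - {{}}"
  shows "atom I G S \<in> finite_borel_sets"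
proof -
  obtain i where i: "i \<in> S"
    using S by blast
  have "atom I G S = (\<Inter>j\<in>I. if j \<in> S then G j else - G j)"
  proof (rule set_eqI)
    fix x
    have "x \<in> atom I G S \<longleftrightarrow> (\<forall>j\<in>I. x \<in> G j \<longleftrightarrow> j \<in> S)"
      using S unfolding atom_def by blast
    then show "x \<in> atom I G S \<longleftrightarrow> x \<in> (\<Inter>j\<in>I. if j \<in> S then G j else - G j)"
      unfolding INT_iff by auto
  qed
  moreover have "(\<Inter>j\<in>I. if j \<in> S then G j else - G j) \<in> sets borel"
    using I i S G by (intro sets.finite_INT) (auto simp: finite_borel_sets_def intro!: borel_comp)
  moreover have "atom I G S \<subseteq> G i"
    using i by (auto simp: atom_def)
  ultimately show ?thesis
    using finite_borel_sets_subset[OF G[of i]] i S by auto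
qed

lemma sum_indicator_eq:
  assumes "finite I"
  shows "(\<Sum>i\<in>I. c i * indicator (G i) x :: real) = (\<Sum>i\<in>{i\<in>I. x \<in> G i}. c i)"
proof -
  have "(\<Sum>i\<in>I. c i * indicator (G i) x) = (\<Sum>i\<in>I. if x \<in> G i then c i else 0)"
    by (intro sum.cong) (auto simp: indicator_def)
  also have "\<dots> = (\<Sum>i\<in>{i\<in>I. x \<in> G i}. c i)"
    using assms by (rule sum.inter_filter[symmetric])
  finally show ?thesis .
qed

lemma approximates_exists:
  fixes f :: "real \<Rightarrow> real"
  assumes f: "integrable lebesgue f"
  shows "\<exists>s. approximates s f"
proof -
  obtain f' where f': "f' \<in> borel_measurable lborel" and eq: "AE x in lborel. f x = f' x"
    using completion_ex_borel_measurable_real[OF borel_measurable_integrable[OF f]] by blast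
  have eq': "AE x in lebesgue. f x = f' x"
    using eq by (rule AE_completion)
  have "integrable lebesgue f'"
    using f f' eq' by (subst integrable_cong_AE[of f' _ f]) (auto intro: measurable_completion)
  then have int: "integrable lborel f'"
    using f' by (simp add: integrable_completion)
  obtain s where s: "\<And>i. simple_function lborel (s i)" and lim: "\<And>x. (\<lambda>i. s i x) \<longlonglongrightarrow> f' x"
    and bound: "\<And>i x. \<bar>s i x\<bar> \<le> 2 * \<bar>f' x\<bar>"
    using borel_measurable_implies_sequence_metric[OF f', of 0] by auto
  have meas: "s i \<in> borel_measurable lborel" for i
    using s by (rule borel_measurable_simple_function)
  have s_int: "integrable lborel (s i)" for i
    by (rule Bochner_Integration.integrable_bound[of _ "\<lambda>x. 2 * f' x"])
      (use int meas bound in \<open>auto simp: abs_mult\<close>)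
  have "(\<lambda>i. \<integral>x. \<bar>s i x - f' x\<bar> \<partial>lborel) \<longlonglongrightarrow> (\<integral>x. 0 \<partial>(lborel :: real measure))"
  proof (rule integral_dominated_convergence[where w = "\<lambda>x. 3 * \<bar>f' x\<bar>"])
    show "AE x in lborel. (\<lambda>i. \<bar>s i x - f' x\<bar>) \<longlonglongrightarrow> 0"
      using lim by (intro always_eventually allI tendsto_rabs_zero) (simp add: LIM_zero)
    show "AE x in lborel. norm \<bar>s i x - f' x\<bar> \<le> 3 * \<bar>f' x\<bar>" for i
    proof (intro always_eventually allI)
      fix x
      show "norm \<bar>s i x - f' x\<bar> \<le> 3 * \<bar>f' x\<bar>"
        using bound[of i x] by simp
    qed
  qed (use int meas f' in auto)
  moreover have "(\<integral>x. \<bar>s i x - f x\<bar> \<partial>lebesgue) = (\<integral>x. \<bar>s i x - f' x\<bar> \<partial>lborel)" for i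
  proof -
    have "(\<integral>x. \<bar>s i x - f x\<bar> \<partial>lebesgue) = (\<integral>x. \<bar>s i x - f' x\<bar> \<partial>lebesgue)"
      using eq' meas[of i] f' f
      by (intro integral_cong_AE)
        (auto intro!: borel_measurable_abs borel_measurable_diff intro: measurable_completion)
    also have "\<dots> = (\<integral>x. \<bar>s i x - f' x\<bar> \<partial>lborel)"
      using meas[of i] f' by (intro integral_completion) auto
    finally show ?thesis .
  qed
  moreover have "AE x in lebesgue. (\<lambda>i. s i x) \<longlonglongrightarrow> f x"
    using eq' by eventually_elim (simp add: lim)
  ultimately have "approximates s f"
    using simple_fun_of_simple_function[OF s s_int] by (simp add: approximates_def)
  then show ?thesis by blast
qed


section \<open>Integration against contractive vector measures\<close>

text \<open>
  The extension from simple functions to \<open>L\<^sup>1\<close> is carried by two properties of a random measure: finite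
  additivity and the bound of the trace norm of \<open>X E\<close> by \<open>\<bar>E\<bar>\<close>.
\<close>

locale contractive_vector_measure = tracial_algebra A \<phi>
  for A :: "('h::complex_hilbert_space) operator set" and \<phi> :: "'h operator \<Rightarrow> complex" +
  fixes X :: "real set \<Rightarrow> 'h operator"
  assumes X_mem: "E \<in> finite_borel_sets \<Longrightarrow> X E \<in> A"
    and X_empty: "X {} = 0"
    and X_Un: "E \<in> finite_borel_sets \<Longrightarrow> F \<in> finite_borel_sets \<Longrightarrow> E \<inter> F = {} \<Longrightarrow>
      X (E \<union> F) = X E + X F"
    and norm1_X_le: "E \<in> finite_borel_sets \<Longrightarrow> norm1 \<phi> (X E) \<le> measure lborel E"
begin

lemma X_UN_disjoint:
  assumes "finite J" "\<And>j. j \<in> J \<Longrightarrow> F j \<in> finite_borel_sets" "disjoint_family_on F J"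
  shows "(\<Union>j\<in>J. F j) \<in> finite_borel_sets \<and> X (\<Union>j\<in>J. F j) = (\<Sum>j\<in>J. X (F j))"
  using assms
proof (induction J)
  case empty
  show ?case
    by (simp add: finite_borel_sets_empty X_empty)
next
  case (insert j J)
  have "disjoint_family_on F J"
    using insert.prems(2) by (rule disjoint_family_on_mono[rotated]) auto
  with insert have IH: "(\<Union>j\<in>J. F j) \<in> finite_borel_sets" "X (\<Union>j\<in>J. F j) = (\<Sum>j\<in>J. X (F j))"
    by auto
  have "F j \<inter> (\<Union>j\<in>J. F j) = {}"
    using insert.prems(2) insert.hyps by (fastforce simp: disjoint_family_on_def)
  then show ?case
    using IH insert.prems insert.hyps by (simp add: finite_borel_sets_Un X_Un)
qed

lemma sum_over_atoms:
  assumes I: "finite I" and G: "\<And>i. i \<in> I \<Longrightarrow> G i \<in> finite_borel_sets"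
  shows "(\<Sum>i\<in>I. c i *\<^sub>R X (G i)) = (\<Sum>S\<in>Pow I - {{}}. (\<Sum>i\<in>S. c i) *\<^sub>R X (atom I G S))"
proof -
  let ?J = "Pow I - {{}}"
  have J: "finite ?J"
    using I by simp
  have "X (G i) = (\<Sum>S\<in>{S\<in>?J. i \<in> S}. X (atom I G S))" if i: "i \<in> I" for i
  proof -
    have "G i = (\<Union>S\<in>{S\<in>?J. i \<in> S}. atom I G S)"
    proof (rule set_eqI)
      fix x
      have "x \<in> (\<Union>S\<in>{S\<in>?J. i \<in> S}. atom I G S) \<longleftrightarrow> {j\<in>I. x \<in> G j} \<in> {S\<in>?J. i \<in> S}"
        unfolding atom_def by blast
      also have "\<dots> \<longleftrightarrow> x \<in> G i"
        using i by blast
      finally show "x \<in> G i \<longleftrightarrow> x \<in> (\<Union>S\<in>{S\<in>?J. i \<in> S}. atom I G S)"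
        by (rule sym)
    qed
    moreover have "disjoint_family_on (atom I G) {S\<in>?J. i \<in> S}"
      unfolding disjoint_family_on_def atom_def by blast
    ultimately show ?thesis
      using X_UN_disjoint[of "{S\<in>?J. i \<in> S}" "atom I G"] J atom_finite_borel[OF I G] by simp
  qed
  then have "(\<Sum>i\<in>I. c i *\<^sub>R X (G i)) = (\<Sum>i\<in>I. \<Sum>S\<in>{S\<in>?J. i \<in> S}. c i *\<^sub>R X (atom I G S))"
    by (simp add: scaleR_sum_right)
  also have "\<dots> = (\<Sum>S\<in>?J. \<Sum>i\<in>{i\<in>I. i \<in> S}. c i *\<^sub>R X (atom I G S))"
    by (rule sum.swap_restrict[OF I J])
  also have "\<dots> = (\<Sum>S\<in>?J. (\<Sum>i\<in>S. c i) *\<^sub>R X (atom I G S))"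
  proof (rule sum.cong[OF refl])
    fix S
    assume "S \<in> ?J"
    then have "{i\<in>I. i \<in> S} = S"
      by auto
    then show "(\<Sum>i\<in>{i\<in>I. i \<in> S}. c i *\<^sub>R X (atom I G S)) = (\<Sum>i\<in>S. c i) *\<^sub>R X (atom I G S)"
      by (simp add: scaleR_sum_left)
  qed
  finally show ?thesis .
qed

lemma sum_eq_0:
  assumes I: "finite I" and G: "\<And>i. i \<in> I \<Longrightarrow> G i \<in> finite_borel_sets"
    and zero: "\<And>x. (\<Sum>i\<in>I. c i * indicator (G i) x :: real) = 0"
  shows "(\<Sum>i\<in>I. c i *\<^sub>R X (G i)) = 0"
proof -
  have "(\<Sum>i\<in>S. c i) *\<^sub>R X (atom I G S) = 0" for S
  proof (cases "atom I G S = {}")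
    case False
    then obtain x where "{i\<in>I. x \<in> G i} = S"
      by (auto simp: atom_def)
    then show ?thesis
      using zero[of x] I by (simp add: sum_indicator_eq)
  qed (simp add: X_empty)
  then show ?thesis
    by (simp only: sum_over_atoms[OF I G]) simp
qed

lemma norm1_sum_le_integral:
  assumes I: "finite I" and G: "\<And>i. i \<in> I \<Longrightarrow> G i \<in> finite_borel_sets"
  shows "norm1 \<phi> (\<Sum>i\<in>I. c i *\<^sub>R X (G i)) \<le> (\<integral>x. \<bar>\<Sum>i\<in>I. c i * indicator (G i) x\<bar> \<partial>lborel)"
proof -
  let ?J = "Pow I - {{}}"
  define d where "d = (\<lambda>S. \<Sum>i\<in>S. c i)"
  have J: "finite ?J"
    using I by simp
  have atom: "atom I G S \<in> finite_borel_sets" if "S \<in> ?J" for S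
    using I G that by (rule atom_finite_borel)
  have pointwise: "(\<Sum>S\<in>?J. \<bar>d S\<bar> * indicator (atom I G S) x) = \<bar>\<Sum>i\<in>I. c i * indicator (G i) x\<bar>" for x
  proof -
    let ?S = "{i\<in>I. x \<in> G i}"
    have "(\<Sum>S\<in>?J. \<bar>d S\<bar> * indicator (atom I G S) x) = (\<Sum>S\<in>?J. if ?S = S then \<bar>d S\<bar> else 0)"
      by (intro sum.cong) (auto simp: atom_def indicator_def)
    also have "\<dots> = (if ?S \<in> ?J then \<bar>d ?S\<bar> else 0)"
      using J by (rule sum.delta')
    also have "\<dots> = \<bar>d ?S\<bar>"
    proof (cases "?S = {}")
      case True
      then show ?thesis
        unfolding True d_def by simp
    next
      case False
      then have "?S \<in> ?J"
        by blast
      then show ?thesis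
        by (simp only: if_True)
    qed
    also have "d ?S = (\<Sum>i\<in>I. c i * indicator (G i) x)"
      unfolding d_def using I by (simp add: sum_indicator_eq)
    finally show ?thesis .
  qed
  have "norm1 \<phi> (\<Sum>i\<in>I. c i *\<^sub>R X (G i)) = norm1 \<phi> (\<Sum>S\<in>?J. d S *\<^sub>R X (atom I G S))"
    unfolding d_def by (simp only: sum_over_atoms[OF I G])
  also have "\<dots> \<le> (\<Sum>S\<in>?J. norm1 \<phi> (d S *\<^sub>R X (atom I G S)))"
    by (intro norm1_sum_le scaleR_mem X_mem atom)
  also have "\<dots> \<le> (\<Sum>S\<in>?J. \<bar>d S\<bar> * measure lborel (atom I G S))"
    by (intro sum_mono) (simp add: norm1_scaleR X_mem atom mult_left_mono norm1_X_le)
  also have "\<dots> = (\<Sum>S\<in>?J. \<integral>x. \<bar>d S\<bar> * indicator (atom I G S) x \<partial>lborel)"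
    by simp
  also have "\<dots> = (\<integral>x. (\<Sum>S\<in>?J. \<bar>d S\<bar> * indicator (atom I G S) x) \<partial>lborel)"
    by (intro Bochner_Integration.integral_sum[symmetric] integrable_mult_right
        integrable_indicator_finite_borel atom)
  finally show ?thesis
    unfolding pointwise .
qed

lemma has_simple_integral_mem:
  assumes "has_simple_integral X s a"
  shows "a \<in> A"
proof -
  obtain n c E where repr: "simple_repr s n c E" and a: "a = (\<Sum>i<n. c i *\<^sub>R X (E i))"
    using assms unfolding has_simple_integral_def by blast
  have "E i \<in> finite_borel_sets" if "i < n" for i
    using repr that by (simp add: simple_repr_def)
  then show ?thesis
    unfolding a by (intro sum_mem scaleR_mem X_mem) simp
qed

text \<open>Two representations are compared by joining them, the second one with opposite signs.\<close>

lemma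
  assumes s: "has_simple_integral X s a" and t: "has_simple_integral X t b"
  shows norm1_simple_integral_diff: "norm1 \<phi> (a - b) \<le> (\<integral>x. \<bar>s x - t x\<bar> \<partial>lborel)"
    and simple_integral_unique: "s = t \<Longrightarrow> a = b"
proof -
  obtain n :: nat and c E where E: "\<And>i. i < n \<Longrightarrow> E i \<in> finite_borel_sets"
    and s_eq: "s = (\<lambda>x. \<Sum>i<n. c i * indicator (E i) x)" and a: "a = (\<Sum>i<n. c i *\<^sub>R X (E i))"
    using s unfolding has_simple_integral_def simple_repr_def by blast
  obtain m :: nat and d F where F: "\<And>i. i < m \<Longrightarrow> F i \<in> finite_borel_sets"
    and t_eq: "t = (\<lambda>x. \<Sum>i<m. d i * indicator (F i) x)" and b: "b = (\<Sum>i<m. d i *\<^sub>R X (F i))"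
    using t unfolding has_simple_integral_def simple_repr_def by blast
  define I where "I = {..<n} <+> {..<m}"
  define G where "G = case_sum E F"
  define e where "e = case_sum c (\<lambda>i. - d i)"
  have I: "finite I"
    by (simp add: I_def)
  have G: "\<And>i. i \<in> I \<Longrightarrow> G i \<in> finite_borel_sets"
    using E F by (auto simp: I_def G_def)
  have diff: "a - b = (\<Sum>i\<in>I. e i *\<^sub>R X (G i))"
    by (simp add: a b I_def G_def e_def sum.Plus sum_negf)
  have pointwise: "s x - t x = (\<Sum>i\<in>I. e i * indicator (G i) x)" for x
    by (simp add: s_eq t_eq I_def G_def e_def sum.Plus sum_negf del: sum_mult_indicator)
  show "norm1 \<phi> (a - b) \<le> (\<integral>x. \<bar>s x - t x\<bar> \<partial>lborel)"
    unfolding diff pointwise using I G by (rule norm1_sum_le_integral)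
  assume "s = t"
  then have "(\<Sum>i\<in>I. e i * indicator (G i) x) = 0" for x
    using pointwise[of x] by simp
  then show "a = b"
    using sum_eq_0[where c = e, OF I G] diff by simp
qed

lemma simple_integral_ex1: "simple_fun s \<Longrightarrow> \<exists>!b. has_simple_integral X s b"
proof (rule ex_ex1I)
  assume "simple_fun s"
  then obtain n :: nat and c E where "simple_repr s n c E"
    by (auto simp: simple_fun_def)
  then have "\<exists>n c E. simple_repr s n c E \<and> (\<Sum>i<n. c i *\<^sub>R X (E i)) = (\<Sum>i<n. c i *\<^sub>R X (E i))"
    by blast
  then show "\<exists>b. has_simple_integral X s b"
    unfolding has_simple_integral_def by blast
next
  show "a = b" if "has_simple_integral X s a" "has_simple_integral X s b" for a b
    using that refl by (rule simple_integral_unique)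
qed

lemma has_simple_integral: "simple_fun s \<Longrightarrow> has_simple_integral X s (simple_integral X s)"
  unfolding simple_integral_def by (rule theI'[OF simple_integral_ex1])

lemma simple_integral_mem: "simple_fun s \<Longrightarrow> simple_integral X s \<in> A"
  by (rule has_simple_integral_mem[OF has_simple_integral])

lemma simple_integral_dist_le:
  assumes "simple_fun s" "simple_fun t"
  shows "norm1 \<phi> (simple_integral X s - simple_integral X t) \<le> (\<integral>x. \<bar>s x - t x\<bar> \<partial>lebesgue)"
proof -
  have "(\<integral>x. \<bar>s x - t x\<bar> \<partial>lebesgue) = (\<integral>x. \<bar>s x - t x\<bar> \<partial>lborel)"
    using assms[THEN simple_fun_integrable, THEN borel_measurable_integrable]
    by (intro integral_completion) simp
  then show ?thesis
    using norm1_simple_integral_diff[OF assms[THEN has_simple_integral]] by simp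
qed

lemma norm1_simple_integral_le:
  assumes "simple_fun s"
  shows "norm1 \<phi> (simple_integral X s) \<le> (\<integral>x. \<bar>s x\<bar> \<partial>lebesgue)"
proof -
  have zero: "has_simple_integral X (\<lambda>_. 0) 0"
    unfolding has_simple_integral_def simple_repr_def
    by (intro exI[of _ 0]) (simp add: disjoint_family_on_def)
  have "(\<integral>x. \<bar>s x\<bar> \<partial>lebesgue) = (\<integral>x. \<bar>s x\<bar> \<partial>lborel)"
    using assms[THEN simple_fun_integrable, THEN borel_measurable_integrable]
    by (intro integral_completion) simp
  then show ?thesis
    using norm1_simple_integral_diff[OF has_simple_integral[OF assms] zero] by simp
qed

text \<open>
  The bound through \<open>f\<close> shows at once that approximating sequences have Cauchy integrals and that any
  two of them have the same limit.
\<close>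

lemma simple_integral_dist_le_via:
  assumes f: "integrable lebesgue f" and s: "simple_fun s" and t: "simple_fun t"
  shows "norm1 \<phi> (simple_integral X s - simple_integral X t)
    \<le> (\<integral>x. \<bar>s x - f x\<bar> \<partial>lebesgue) + (\<integral>x. \<bar>t x - f x\<bar> \<partial>lebesgue)"
proof -
  have int: "integrable lebesgue (\<lambda>x. \<bar>s x - f x\<bar>)" "integrable lebesgue (\<lambda>x. \<bar>t x - f x\<bar>)"
    "integrable lebesgue (\<lambda>x. \<bar>s x - t x\<bar>)"
    using f simple_fun_integrable_lebesgue[OF s] simple_fun_integrable_lebesgue[OF t] by auto
  have "norm1 \<phi> (simple_integral X s - simple_integral X t) \<le> (\<integral>x. \<bar>s x - t x\<bar> \<partial>lebesgue)"
    by (rule simple_integral_dist_le[OF s t])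
  also have "\<dots> \<le> (\<integral>x. \<bar>s x - f x\<bar> + \<bar>t x - f x\<bar> \<partial>lebesgue)"
    using int by (intro integral_mono) auto
  also have "\<dots> = (\<integral>x. \<bar>s x - f x\<bar> \<partial>lebesgue) + (\<integral>x. \<bar>t x - f x\<bar> \<partial>lebesgue)"
    using int by (intro Bochner_Integration.integral_add)
  finally show ?thesis .
qed

lemma simple_integral_Cauchy:
  assumes f: "integrable lebesgue f" and s: "approximates s f"
  shows "(\<lambda>n. simple_integral X (s n)) \<in> L1_Cauchy A \<phi>"
proof -
  have simple: "simple_fun (s n)" for n
    using s by (simp add: approximates_def)
  have lim: "(\<lambda>n. \<integral>x. \<bar>s n x - f x\<bar> \<partial>lebesgue) \<longlonglongrightarrow> 0"
    using s by (simp add: approximates_def)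
  have "\<exists>N. \<forall>m\<ge>N. \<forall>n\<ge>N. norm1 \<phi> (simple_integral X (s m) - simple_integral X (s n)) < e"
    if "0 < e" for e
  proof -
    have "\<forall>\<^sub>F n in sequentially. (\<integral>x. \<bar>s n x - f x\<bar> \<partial>lebesgue) < e / 2"
      using lim that by (intro order_tendstoD) auto
    then obtain N where N: "\<And>n. N \<le> n \<Longrightarrow> (\<integral>x. \<bar>s n x - f x\<bar> \<partial>lebesgue) < e / 2"
      by (auto simp: eventually_sequentially)
    show ?thesis
    proof (intro exI allI impI)
      fix m n
      assume "N \<le> m" "N \<le> n"
      then show "norm1 \<phi> (simple_integral X (s m) - simple_integral X (s n)) < e"
        using simple_integral_dist_le_via[OF f simple simple, of m n] N[of m] N[of n] by linarith
    qed
  qed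
  then show ?thesis
    by (simp add: L1_Cauchy_def simple_integral_mem[OF simple])
qed

lemma is_integral_class:
  assumes f: "integrable lebesgue f" and s: "approximates s f"
  shows "is_integral A \<phi> X f (L1_rel A \<phi> `` {\<lambda>n. simple_integral X (s n)})"
  unfolding is_integral_def
proof (intro conjI allI impI)
  let ?u = "\<lambda>n. simple_integral X (s n)"
  have u: "?u \<in> L1_Cauchy A \<phi>"
    using f s by (rule simple_integral_Cauchy)
  then show "L1_rel A \<phi> `` {?u} \<in> L1_space A \<phi>"
    by (rule L1_spaceI)
  have simple: "simple_fun (s n)" for n
    using s by (simp add: approximates_def)
  fix t
  assume t: "approximates t f"
  then have simple': "simple_fun (t n)" for n
    by (simp add: approximates_def)
  let ?D = "\<lambda>n. L1_dist \<phi> (L1_embed A \<phi> (simple_integral X (t n))) (L1_rel A \<phi> `` {?u})"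
  have D: "(\<lambda>k. norm1 \<phi> (simple_integral X (t n) - ?u k)) \<longlonglongrightarrow> ?D n" for n
    unfolding L1_embed_def
    by (intro tendsto_L1_dist L1_Cauchy_const simple_integral_mem simple' u)
  have "0 \<le> ?D n" for n
    using D by (rule LIMSEQ_le_const)
      (auto intro!: norm1_nonneg diff_mem simple_integral_mem simple simple')
  moreover have "?D n \<le> (\<integral>x. \<bar>t n x - f x\<bar> \<partial>lebesgue) + 0" for n
  proof (rule LIMSEQ_le[OF D tendsto_add[OF tendsto_const]])
    show "(\<lambda>k. \<integral>x. \<bar>s k x - f x\<bar> \<partial>lebesgue) \<longlonglongrightarrow> 0"
      using s by (simp add: approximates_def)
  qed (intro exI allI impI, rule simple_integral_dist_le_via[OF f simple' simple])
  moreover have "(\<lambda>n. (\<integral>x. \<bar>t n x - f x\<bar> \<partial>lebesgue) + 0) \<longlonglongrightarrow> 0"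
    using t by (simp add: approximates_def)
  ultimately show "?D \<longlonglongrightarrow> 0"
    by (rule tendsto_sandwich[OF always_eventually always_eventually tendsto_const, OF allI allI])
qed

text \<open>Both classes are limits of the same simple integrals, so their distance vanishes.\<close>

lemma is_integral_unique:
  assumes f: "integrable lebesgue f" and \<xi>: "is_integral A \<phi> X f \<xi>" and \<eta>: "is_integral A \<phi> X f \<eta>"
  shows "\<xi> = \<eta>"
proof -
  obtain s where s: "approximates s f"
    using approximates_exists[OF f] by blast
  obtain u where u: "u \<in> L1_Cauchy A \<phi>" "\<xi> = L1_rel A \<phi> `` {u}"
    using \<xi> unfolding is_integral_def by (auto elim: L1_spaceE)
  obtain v where v: "v \<in> L1_Cauchy A \<phi>" "\<eta> = L1_rel A \<phi> `` {v}"
    using \<eta> unfolding is_integral_def by (auto elim: L1_spaceE)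
  let ?a = "\<lambda>n. L1_embed A \<phi> (simple_integral X (s n))"
  have "(\<lambda>n. L1_dist \<phi> (?a n) \<xi>) \<longlonglongrightarrow> 0" "(\<lambda>n. L1_dist \<phi> (?a n) \<eta>) \<longlonglongrightarrow> 0"
    using \<xi> \<eta> s unfolding is_integral_def by blast+
  from tendsto_add[OF this] have "(\<lambda>n. L1_dist \<phi> (?a n) \<xi> + L1_dist \<phi> (?a n) \<eta>) \<longlonglongrightarrow> 0"
    by simp
  moreover have "L1_dist \<phi> \<xi> \<eta> \<le> L1_dist \<phi> (?a n) \<xi> + L1_dist \<phi> (?a n) \<eta>" for n
    unfolding u(2) v(2) L1_embed_def using s
    by (intro L1_dist_triangle L1_Cauchy_const simple_integral_mem u(1) v(1))
      (simp add: approximates_def)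
  ultimately have "L1_dist \<phi> \<xi> \<eta> \<le> 0"
    by (intro LIMSEQ_le_const) auto
  moreover have lim: "(\<lambda>n. norm1 \<phi> (u n - v n)) \<longlonglongrightarrow> L1_dist \<phi> \<xi> \<eta>"
    unfolding u(2) v(2) by (rule tendsto_L1_dist[OF u(1) v(1)])
  then have "0 \<le> L1_dist \<phi> \<xi> \<eta>"
    by (rule LIMSEQ_le_const)
      (use L1_Cauchy_mem[OF u(1)] L1_Cauchy_mem[OF v(1)] in \<open>auto intro!: norm1_nonneg diff_mem\<close>)
  ultimately have "L1_dist \<phi> \<xi> \<eta> = 0"
    by simp
  with lim show ?thesis
    unfolding u(2) v(2) by (intro L1_class_eqI u(1) v(1)) simp
qed

lemma free_integral_eq:
  assumes "integrable lebesgue f" "approximates s f"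
  shows "free_integral A \<phi> X f = L1_rel A \<phi> `` {\<lambda>n. simple_integral X (s n)}"
proof -
  have int: "is_integral A \<phi> X f (L1_rel A \<phi> `` {\<lambda>n. simple_integral X (s n)})"
    by (rule is_integral_class[OF assms])
  show ?thesis
    unfolding free_integral_def
    by (rule the_equality[where P = "is_integral A \<phi> X f", OF int])
      (erule is_integral_unique[OF assms(1) _ int])
qed

lemma L1_norm_free_integral_le:
  assumes f: "integrable lebesgue f"
  shows "L1_norm \<phi> (free_integral A \<phi> X f) \<le> (\<integral>x. \<bar>f x\<bar> \<partial>lebesgue)"
proof -
  obtain s where s: "approximates s f"
    using approximates_exists[OF f] by blast
  have simple: "simple_fun (s n)" for n
    using s by (simp add: approximates_def)
  have "norm1 \<phi> (simple_integral X (s n))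
      \<le> (\<integral>x. \<bar>f x\<bar> \<partial>lebesgue) + (\<integral>x. \<bar>s n x - f x\<bar> \<partial>lebesgue)" for n
  proof -
    have int: "integrable lebesgue (s n)"
      using simple by (rule simple_fun_integrable_lebesgue)
    have "norm1 \<phi> (simple_integral X (s n)) \<le> (\<integral>x. \<bar>s n x\<bar> \<partial>lebesgue)"
      by (rule norm1_simple_integral_le[OF simple])
    also have "\<dots> \<le> (\<integral>x. \<bar>f x\<bar> + \<bar>s n x - f x\<bar> \<partial>lebesgue)"
      using f int by (intro integral_mono) auto
    also have "\<dots> = (\<integral>x. \<bar>f x\<bar> \<partial>lebesgue) + (\<integral>x. \<bar>s n x - f x\<bar> \<partial>lebesgue)"
      using f int by (intro Bochner_Integration.integral_add) auto
    finally show ?thesis .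
  qed
  moreover have "(\<lambda>n. (\<integral>x. \<bar>f x\<bar> \<partial>lebesgue) + (\<integral>x. \<bar>s n x - f x\<bar> \<partial>lebesgue))
      \<longlonglongrightarrow> (\<integral>x. \<bar>f x\<bar> \<partial>lebesgue) + 0"
    using s by (intro tendsto_add tendsto_const) (simp add: approximates_def)
  ultimately have "L1_norm \<phi> (L1_rel A \<phi> `` {\<lambda>n. simple_integral X (s n)})
      \<le> (\<integral>x. \<bar>f x\<bar> \<partial>lebesgue) + 0"
    by (intro LIMSEQ_le[OF tendsto_L1_norm[OF simple_integral_Cauchy[OF f s]]]) auto
  then show ?thesis
    by (simp add: free_integral_eq[OF f s])
qed

end


section \<open>Free Poisson random measures\<close>

text \<open>The one-block partition is the only partition of a point, so \<open>\<kappa>\<^sub>1\<close> is the mean.\<close>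

lemma free_cumulant_single: "free_cumulant \<phi> [a] = \<phi> a"
proof -
  have "P \<notin> NC 1 - {{{..<1}}}" for P
  proof
    assume P: "P \<in> NC 1 - {{{..<1}}}"
    then have part: "partition_on {..<1} P"
      by (simp add: NC_def)
    then obtain V where V: "V \<in> P" "V \<noteq> {}"
      by (auto simp: partition_on_def)
    then have "V \<subset> {..<1}"
      using NC_proper_block[OF P] by blast
    with V show False by auto
  qed
  then have "NC (length [a]) - {{{..<length [a]}}} = {}"
    by auto
  then show ?thesis
    by (subst free_cumulant.simps, simp only:) (simp add: op_prod_def)
qed

text \<open>
  Positivity gives \<open>\<bar>X E\<bar> = X E\<close>, so the trace norm of \<open>X E\<close> is its mean, the first free cumulant.
\<close>

lemma free_poisson_contractive_vector_measure:
  assumes W: "wstar_probability_space A \<phi>"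
    and X: "free_poisson_random_measure A \<phi> X"
    and pos: "\<forall>E\<in>finite_borel_sets. op_positive (X E)"
  shows "contractive_vector_measure A \<phi> X"
proof -
  interpret tracial_algebra A \<phi>
    using W by unfold_locales
      (auto simp: wstar_probability_space_def finite_von_neumann_algebra_def)
  have additive: "X (\<Union>i<k. E i) = (\<Sum>i<k. X (E i))"
    if "1 \<le> k" "\<forall>i<k. E i \<in> finite_borel_sets" "disjoint_family_on E {..<k}" for k :: nat and E
    using X that unfolding free_poisson_random_measure_def by blast
  have Un: "X (E \<union> F) = X E + X F"
    if "E \<in> finite_borel_sets" "F \<in> finite_borel_sets" "E \<inter> F = {}" for E F
  proof -
    define G where "G = (\<lambda>i::nat. if i = 0 then E else F)"
    have two: "{..<2} = {0, 1::nat}"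
      by auto
    have "X (\<Union>i<2. G i) = (\<Sum>i<2. X (G i))"
    proof (rule additive)
      show "\<forall>i<2. G i \<in> finite_borel_sets"
        using that by (simp add: G_def)
      show "disjoint_family_on G {..<2}"
        unfolding two using that(3) by (simp add: disjoint_family_on_def G_def Int_commute)
    qed simp
    then show ?thesis
      unfolding two by (simp add: G_def Un_commute)
  qed
  show ?thesis
  proof
    show "X E \<in> A" if "E \<in> finite_borel_sets" for E
      using X that unfolding free_poisson_random_measure_def by blast
    show "X {} = 0"
      using Un[OF finite_borel_sets_empty finite_borel_sets_empty] by simp
    show "norm1 \<phi> (X E) \<le> measure lborel E" if E: "E \<in> finite_borel_sets" for E
    proof -
      have "free_cumulant \<phi> (replicate 1 (X E)) = complex_of_real (measure lborel E)"
        using X E unfolding free_poisson_random_measure_def by blast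
      then have "\<phi> (X E) = complex_of_real (measure lborel E)"
        by (simp add: free_cumulant_single)
      then show ?thesis
        using pos E by (simp add: norm1_of_positive)
    qed
  qed (rule Un)
qed

theorem theorem5p7:
  fixes A :: "('h::complex_hilbert_space) operator set"
    and \<phi> :: "'h operator \<Rightarrow> complex"
    and X :: "real set \<Rightarrow> 'h operator"
  assumes "wstar_probability_space A \<phi>"
    and "free_poisson_random_measure A \<phi> X"
    and "\<forall>E\<in>finite_borel_sets. op_positive (X E)"
  shows "(\<forall>s. simple_fun s \<longrightarrow> (\<exists>!b. has_simple_integral X s b)) \<and>
    (\<forall>f :: real \<Rightarrow> real. integrable lebesgue f \<longrightarrow>
       (\<exists>s. approximates s f) \<and>
       (\<exists>!\<xi>. is_integral A \<phi> X f \<xi>) \<and>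
       free_integral A \<phi> X f \<in> L1_space A \<phi> \<and>
       L1_norm \<phi> (free_integral A \<phi> X f) \<le> (\<integral>x. \<bar>f x\<bar> \<partial>lebesgue))"
proof -
  interpret contractive_vector_measure A \<phi> X
    using assms by (rule free_poisson_contractive_vector_measure)
  have "(\<exists>s. approximates s f) \<and> (\<exists>!\<xi>. is_integral A \<phi> X f \<xi>) \<and>
      free_integral A \<phi> X f \<in> L1_space A \<phi> \<and>
      L1_norm \<phi> (free_integral A \<phi> X f) \<le> (\<integral>x. \<bar>f x\<bar> \<partial>lebesgue)"
    if f: "integrable lebesgue f" for f :: "real \<Rightarrow> real"
  proof -
    obtain s where s: "approximates s f"
      using approximates_exists[OF f] by blast
    have int: "is_integral A \<phi> X f (free_integral A \<phi> X f)"
      using is_integral_class[OF f s] by (simp add: free_integral_eq[OF f s])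
    then have "free_integral A \<phi> X f \<in> L1_space A \<phi>"
      by (simp add: is_integral_def)
    with s int show ?thesis
      using is_integral_unique[OF f] L1_norm_free_integral_le[OF f] by blast
  qed
  then show ?thesis
    using simple_integral_ex1 by blast
qed

end
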